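(* Let $R$ be a euclidean domain with $R=2R$. Let $n\geq 2$ and let $\varphi$ be a skew-symmetric matrix of size $2n\times 2n$ over $R$ of Pfaffian $1$. Then $\mathrm{Sp}_{\varphi}(R)=\mathrm{ESp}_{\varphi}(R)$.
   Context: Rings are commutative with unity. $R^{m}$ denotes column vectors of length $m$, $\mathrm{M}_m(R)$ the $m\times m$ matrices over $R$, $I_m$ the identity matrix, and $\gamma^t$ the transpose of $\gamma$. The condition $R=2R$ means that $2$ is a unit in $R$. The Pfaffian is normalized so that the standard skew-symmetric matrix $\psi_n=\sum_{i=1}^{n}(e_{2i-1,2i}-e_{2i,2i-1})$ has Pfaffian $1$, where $e_{ij}$ is the matrix with $1$ in position $(i,j)$ and $0$ elsewhere. A skew-symmetric matrix of Pfaffian $1$ is invertible. Symplectic group with respect to $\varphi$: for an invertible skew-symmetric matrix $\varphi$ of size $2n$, $$\mathrm{Sp}_\varphi(R)=\{\alpha\in\mathrm{GL}_{2n}(R) : \alpha^t\varphi\alpha=\varphi\}.$$ Elementary symplectic group with respect to $\varphi$: write $$\varphi=\begin{pmatrix} 0 & -c^t\\ c & \nu \end{pmatrix},\qquad \varphi^{-1}=\begin{pmatrix} 0 & d^t\\ -d & \mu \end{pmatrix},$$ with $c,d\in R^{2n-1}$ and $\nu,\mu\in\mathrm{M}_{2n-1}(R)$. For $v\in R^{2n-1}$ put $$\alpha_\varphi(v)=I_{2n-1}+dv^t\nu,\qquad \beta_\varphi(v)=I_{2n-1}+\mu vc^t,$$ $$C_\varphi(v)=\begin{pmatrix} 1&0\\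 v&\alpha_\varphi(v)\end{pmatrix},\qquad R_\varphi(v)=\begin{pmatrix} 1&v^t\\ 0&\beta_\varphi(v)\end{pmatrix}.$$ These matrices belong to $\mathrm{Sp}_\varphi(R)$, and $\mathrm{ESp}_\varphi(R)$ is the subgroup of $\mathrm{Sp}_\varphi(R)$ generated by all $C_\varphi(v)$ and $R_\varphi(v)$ with $v\in R^{2n-1}$. *)

theory Defs
  imports
    "HOL-Algebra.Generated_Groups"
    "Jordan_Normal_Form.Matrix"
    "Jordan_Normal_Form.Determinant"
begin

definition skew_symmetric_mat :: "'a::comm_ring_1 mat \<Rightarrow> bool" where
  "skew_symmetric_mat A \<longleftrightarrow> square_mat A \<and> A\<^sup>T = - A"

(* Sum over the perfect matchings {p 0, p 1}, {p 2, p 3}, ... of the index set {0..<2n}. Each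
   matching is represented by its unique permutation p with p (2i) < p (2i+1) and
   p 0 < p 2 < p 4 < ...  The matching of the identity contributes
   A(0,1) A(2,3) ... with sign +1, so the standard matrix psi_n has Pfaffian 1.
   Only meaningful for matrices of even size. *)
definition pfaffian :: "'a::comm_ring_1 mat \<Rightarrow> 'a" where
  "pfaffian A = (let n = dim_row A div 2 in
     \<Sum>p | p permutes {0..<2 * n} \<and> (\<forall>i<n. p (2 * i) < p (2 * i + 1)) \<and>
           (\<forall>i<n. \<forall>j<n. i < j \<longrightarrow> p (2 * i) < p (2 * j)).
       signof p * (\<Prod>i<n. A $$ (p (2 * i), p (2 * i + 1))))"

definition GL :: "'a::comm_ring_1 itself \<Rightarrow> nat \<Rightarrow> 'a mat monoid" where
  "GL ty m = units_of (ring_mat ty m ())"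

definition mat_inv :: "'a::comm_ring_1 mat \<Rightarrow> 'a mat" where
  "mat_inv A = inv\<^bsub>ring_mat TYPE('a) (dim_row A) ()\<^esub> A"

definition Sp :: "'a::comm_ring_1 mat \<Rightarrow> 'a mat set" where
  "Sp \<phi> = {\<alpha> \<in> carrier (GL TYPE('a) (dim_row \<phi>)). \<alpha>\<^sup>T * \<phi> * \<alpha> = \<phi>}"

definition Sp_group :: "'a::comm_ring_1 mat \<Rightarrow> 'a mat monoid" where
  "Sp_group \<phi> = (GL TYPE('a) (dim_row \<phi>))\<lparr>carrier := Sp \<phi>\<rparr>"

(* The blocks in  phi = (0, -c^t; c, nu)  and  phi^(-1) = (0, d^t; -d, mu).  Column vectors of
   length m are m x 1 matrices throughout. *)
definition c_block :: "'a::comm_ring_1 mat \<Rightarrow> 'a mat" where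
  "c_block \<phi> = (case split_block \<phi> 1 1 of (_, _, c, _) \<Rightarrow> c)"

definition nu_block :: "'a::comm_ring_1 mat \<Rightarrow> 'a mat" where
  "nu_block \<phi> = (case split_block \<phi> 1 1 of (_, _, _, \<nu>) \<Rightarrow> \<nu>)"

definition d_block :: "'a::comm_ring_1 mat \<Rightarrow> 'a mat" where
  "d_block \<phi> = (case split_block (mat_inv \<phi>) 1 1 of (_, dt, _, _) \<Rightarrow> dt\<^sup>T)"

definition mu_block :: "'a::comm_ring_1 mat \<Rightarrow> 'a mat" where
  "mu_block \<phi> = (case split_block (mat_inv \<phi>) 1 1 of (_, _, _, \<mu>) \<Rightarrow> \<mu>)"

definition sp_alpha :: "'a::comm_ring_1 mat \<Rightarrow> 'a mat \<Rightarrow> 'a mat" where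
  "sp_alpha \<phi> v = 1\<^sub>m (dim_row \<phi> - 1) + d_block \<phi> * v\<^sup>T * nu_block \<phi>"

definition sp_beta :: "'a::comm_ring_1 mat \<Rightarrow> 'a mat \<Rightarrow> 'a mat" where
  "sp_beta \<phi> v = 1\<^sub>m (dim_row \<phi> - 1) + mu_block \<phi> * v * (c_block \<phi>)\<^sup>T"

definition C_mat :: "'a::comm_ring_1 mat \<Rightarrow> 'a mat \<Rightarrow> 'a mat" where
  "C_mat \<phi> v = four_block_mat (1\<^sub>m 1) (0\<^sub>m 1 (dim_row \<phi> - 1)) v (sp_alpha \<phi> v)"

definition R_mat :: "'a::comm_ring_1 mat \<Rightarrow> 'a mat \<Rightarrow> 'a mat" where
  "R_mat \<phi> v = four_block_mat (1\<^sub>m 1) (v\<^sup>T) (0\<^sub>m (dim_row \<phi> - 1) 1) (sp_beta \<phi> v)"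

definition ESp :: "'a::comm_ring_1 mat \<Rightarrow> 'a mat set" where
  "ESp \<phi> = generate (Sp_group \<phi>)
     (C_mat \<phi> ` carrier_mat (dim_row \<phi> - 1) 1 \<union> R_mat \<phi> ` carrier_mat (dim_row \<phi> - 1) 1)"

end

theory Submission
  imports Defs "HOL-Library.Function_Algebras"
begin

text \<open>
  Write \<open>B x y = x\<^sup>t \<phi> y\<close>, let \<open>e0\<close> be the first unit vector and \<open>w0 = (0, d)\<close>, so that
  \<open>B w0 x\<close> is the first coordinate of \<open>x\<close>. The generators \<open>C\<^sub>\<phi>(v)\<close> and \<open>R\<^sub>\<phi>(v)\<close> are the
  Eichler transformations attached to the isotropic vectors \<open>w0\<close> and \<open>e0\<close>. With the Euclidean
  algorithm on the pair \<open>(B w0 x, B e0 x)\<close> they move every unimodular vector to \<open>e0\<close>; conjugating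
  the transvection at \<open>e0\<close> therefore shows that \<open>ESp\<^sub>\<phi>(R)\<close> contains the transvection at every
  unimodular vector.

  Conversely every isometry is a product of such transvections. If the isometry is the identity
  modulo a summand \<open>M\<close>, choose a hyperbolic pair \<open>e, f\<close> in \<open>M\<close> (it exists because \<open>\<phi>\<close> is
  invertible and the ring is Euclidean), bring the images of \<open>e\<close> and \<open>f\<close> back to \<open>e\<close> and \<open>f\<close>
  by transvections at vectors of \<open>M\<close>, and continue with the orthogonal complement of \<open>e, f\<close> in
  \<open>M\<close>. No symplectic basis is needed.

  The Pfaffian enters only through the invertibility of \<open>\<phi>\<close>.
\<close>

section \<open>Isometries of alternating forms over Euclidean rings\<close>

locale alternating_form = Modules.module scale
  for scale :: "'a::euclidean_ring \<Rightarrow> 'v::ab_group_add \<Rightarrow> 'v" (infixr "*s" 75) +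
  fixes B :: "'v \<Rightarrow> 'v \<Rightarrow> 'a"
  assumes B_add_left: "B (x + y) z = B x z + B y z"
    and B_add_right: "B x (y + z) = B x y + B x z"
    and B_scale_left: "B (a *s x) y = a * B x y"
    and B_scale_right: "B x (a *s y) = a * B x y"
    and B_self: "B x x = 0"
begin

lemma B_skew: "B x y = - B y x"
proof -
  have "0 = B (x + y) (x + y)" by (rule B_self[symmetric])
  also have "\<dots> = B x y + B y x"
    by (subst B_add_left, subst (1 2) B_add_right) (simp add: B_self)
  finally show ?thesis by (metis eq_neg_iff_add_eq_0)
qed

lemma B_zero_left: "B 0 x = 0"
  using B_scale_left[of 0 0 x] by simp

lemma B_zero_right: "B x 0 = 0"
  using B_scale_right[of x 0 0] by simp

lemma B_minus_left: "B (- x) y = - B x y"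
  using B_scale_left[of "-1" x y] by simp

lemma B_minus_right: "B x (- y) = - B x y"
  using B_scale_right[of x "-1" y] by simp

lemma B_diff_left: "B (x - y) z = B x z - B y z"
  using B_add_left[of x "- y" z] by (simp add: B_minus_left)

lemma B_diff_right: "B z (x - y) = B z x - B z y"
  using B_add_right[of z x "- y"] by (simp add: B_minus_right)

lemmas B_simps = B_add_left B_add_right B_scale_left B_scale_right B_self
  B_zero_left B_zero_right B_minus_left B_minus_right B_diff_left B_diff_right

section \<open>Transvections and their action on unimodular vectors\<close>

definition transv :: "'a \<Rightarrow> 'v \<Rightarrow> 'v \<Rightarrow> 'v" where
  "transv t u x = x + (t * B u x) *s u"

text \<open>The partner \<open>v\<close> makes \<open>u\<close> unimodular inside \<open>M\<close>,
  and keeping \<open>u\<close> in \<open>M\<close> confines displacements to \<open>M\<close>.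
  Composition alone yields a group, since \<open>transv (- t) u\<close> undoes
  \<open>transv t u\<close>.\<close>

inductive_set transv_grp :: "'v set \<Rightarrow> ('v \<Rightarrow> 'v) set" for M where
  id_in: "id \<in> transv_grp M"
| transv_comp: "g \<in> transv_grp M \<Longrightarrow> u \<in> M \<Longrightarrow> v \<in> M \<Longrightarrow> B u v = 1 \<Longrightarrow>
    transv t u \<circ> g \<in> transv_grp M"

lemma transv_in_grp:
  assumes "u \<in> M" "v \<in> M" "B u v = 1"
  shows "transv t u \<in> transv_grp M"
  using transv_comp[OF id_in assms, of t] by simp

lemma transv_grp_comp:
  assumes "h \<in> transv_grp M" "g \<in> transv_grp M"
  shows "h \<circ> g \<in> transv_grp M"
  using assms(1)
proof induction
  case id_in
  then show ?case using assms(2) by simp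
next
  case (transv_comp h u v t)
  then show ?case unfolding comp_assoc by (metis transv_grp.transv_comp)
qed

lemma transv_grp_mono:
  assumes "M \<subseteq> M'" "h \<in> transv_grp M"
  shows "h \<in> transv_grp M'"
  using assms(2)
proof induction
  case id_in
  then show ?case by (rule transv_grp.id_in)
next
  case (transv_comp h u v t)
  then show ?case using assms(1) by (meson subsetD transv_grp.transv_comp)
qed

lemma transv_isometry: "B (transv t u x) (transv t u y) = B x y"
  using B_skew[of x u] by (simp add: transv_def B_simps algebra_simps)

lemma transv_grp_isometry: "h \<in> transv_grp M \<Longrightarrow> B (h x) (h y) = B x y"
  by (induction rule: transv_grp.induct) (simp_all add: transv_isometry)

lemma transv_grp_displacement:
  assumes "subspace M" "h \<in> transv_grp M"
  shows "h x - x \<in> M"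
  using assms(2)
proof induction
  case id_in
  then show ?case using assms(1) by (simp add: subspace_0)
next
  case (transv_comp h u v t)
  have "transv t u (h x) - x = (h x - x) + (t * B u (h x)) *s u"
    by (simp add: transv_def)
  also have "\<dots> \<in> M"
    using transv_comp assms(1) by (intro subspace_add subspace_scale)
  finally show ?case by simp
qed

text \<open>This is the Euclidean algorithm on the pair \<open>B e x\<close>, \<open>B f x\<close>:
  a transvection at \<open>f\<close> reduces \<open>e\<close> modulo \<open>f\<close>, whereas
  reducing \<open>f\<close> modulo \<open>e1\<close> merely changes the chosen partner of
  \<open>e1\<close>.\<close>

lemma reach_orthogonal_partner:
  assumes M: "subspace M" and "e \<in> M" "f \<in> M" "B e f = 1"
  shows "\<exists>g \<in> transv_grp M. \<exists>f' \<in> M. B (g e) f' = 1 \<and> B f' x = 0"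
  using assms(2-)
proof (induction "euclidean_size (B f x)" arbitrary: e f rule: less_induct)
  case less
  note mem = subspace_add[OF M] subspace_diff[OF M] subspace_scale[OF M] subspace_neg[OF M]
  have fe: "B f e = -1" using less.prems B_skew[of f e] by simp
  define a b where "a = B e x" and "b = B f x"
  have T: "transv t f \<in> transv_grp M" for t
    using transv_in_grp[of f M "- e" t] less.prems fe mem by (simp add: B_simps)
  have Te: "transv t f e = e - t *s f" for t
    by (simp add: transv_def fe)
  show ?case
  proof (cases "b = 0")
    case True
    then show ?thesis using less.prems by (intro bexI[OF _ id_in]) (auto simp: b_def)
  next
    case b: False
    define e1 where "e1 = e - (a div b) *s f"
    have e1M: "e1 \<in> M" using less.prems mem by (simp add: e1_def)
    have e1f: "B e1 f = 1" using less.prems by (simp add: e1_def B_simps)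
    have a1: "B e1 x = a mod b"
      by (simp add: e1_def B_simps a_def b_def minus_div_mult_eq_mod)
    show ?thesis
    proof (cases "a mod b = 0")
      case True
      \<comment> \<open>Here \<open>e1\<close> is orthogonal to \<open>x\<close>, so it is made the
        partner: one further step moves \<open>e\<close> to \<open>e1 - f\<close>, and
        \<open>B (e1 - f) e1 = 1\<close>.\<close>
      define e2 where "e2 = e1 - f"
      have "transv (a div b + 1) f e = e2"
        by (simp add: Te e2_def e1_def scale_left_distrib)
      moreover have "B e2 (f + e2) = 1" "B (f + e2) x = 0"
        using e1f True a1 B_skew[of f e1] by (simp_all add: e2_def B_simps)
      moreover have "f + e2 \<in> M" using e1M by (simp add: e2_def)
      ultimately show ?thesis using T by metis
    next
      case False
      define f1 where "f1 = f - (b div (a mod b)) *s e1"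
      have "B f1 x = b mod (a mod b)"
        using a1 by (simp add: f1_def B_simps b_def minus_div_mult_eq_mod)
      then have "euclidean_size (B f1 x) < euclidean_size (B f x)"
        using mod_size_less[OF False, of b] mod_size_less[OF b, of a] by (simp add: b_def)
      moreover have "f1 \<in> M" using less.prems e1M mem by (simp add: f1_def)
      moreover have "B e1 f1 = 1" using e1f by (simp add: f1_def B_simps)
      ultimately obtain g f' where g: "g \<in> transv_grp M" "f' \<in> M" "B (g e1) f' = 1" "B f' x = 0"
        using less.hyps e1M by blast
      have "g \<circ> transv (a div b) f \<in> transv_grp M" using g T transv_grp_comp by blast
      moreover have "(g \<circ> transv (a div b) f) e = g e1" by (simp add: Te e1_def)
      ultimately show ?thesis using g by metis
    qed
  qed
qed

text \<open>If \<open>B y x = 1\<close>, the single transvection at \<open>x - y\<close> with factor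
  \<open>-1\<close> sends \<open>y\<close> to \<open>x\<close>. The earlier moves produce such a
  \<open>y\<close> from \<open>e\<close>, using a vector that pairs to 1 with both the current
  vector and \<open>x\<close>.\<close>

lemma transv_grp_transitive:
  assumes M: "subspace M" and e: "e \<in> M" "f \<in> M" "B e f = 1"
    and x: "x \<in> M" "z \<in> M" "B x z = 1"
  shows "\<exists>g \<in> transv_grp M. g e = x"
proof -
  note mem = subspace_add[OF M] subspace_diff[OF M] subspace_scale[OF M] subspace_neg[OF M]
  obtain g f1 where g: "g \<in> transv_grp M" "f1 \<in> M" "B (g e) f1 = 1" "B f1 x = 0"
    using reach_orthogonal_partner[OF M e] by blast
  define e1 where "e1 = g e"
  have e1: "e1 \<in> M"
    using transv_grp_displacement[OF M g(1), of e] mem(1)[OF _ e(1)]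
    by (metis e1_def diff_add_cancel)
  \<comment> \<open>Thanks to \<open>B f1 x = 0\<close>, the correction by \<open>f1\<close> gives
    \<open>B e1 f2 = 1\<close> while keeping \<open>B x f2 = B x z = 1\<close>.\<close>
  define f2 where "f2 = f1 + z - B e1 z *s f1"
  have f2: "f2 \<in> M" using g x mem by (simp add: f2_def)
  have e1f2: "B e1 f2 = 1" using g by (simp add: f2_def B_simps e1_def)
  have f2x: "B f2 x = -1" using g x B_skew[of z x] by (simp add: f2_def B_simps)
  have f2e1: "B f2 e1 = -1" using e1f2 B_skew[of f2 e1] by simp
  \<comment> \<open>Subtracting \<open>t *s f2\<close> from \<open>e1\<close> adds \<open>t\<close>
    to its value against \<open>x\<close>, which brings that value to 1.\<close>
  define t where "t = 1 - B e1 x"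
  define e2 where "e2 = e1 - t *s f2"
  have T1: "transv t f2 \<in> transv_grp M"
    using transv_in_grp[of f2 M "- e1" t] f2 e1 f2e1 mem by (simp add: B_simps)
  have T1e: "transv t f2 e1 = e2" by (simp add: transv_def f2e1 e2_def)
  have e2: "e2 \<in> M" using e1 f2 mem by (simp add: e2_def)
  have "B e2 x = 1" using f2x by (simp add: e2_def B_simps t_def)
  then have xe2: "B (x - e2) e2 = -1" using B_skew[of x e2] by (simp add: B_simps)
  have T2: "transv (-1) (x - e2) \<in> transv_grp M"
    using transv_in_grp[of "x - e2" M "- e2" "-1"] x e2 xe2 mem by (simp add: B_simps)
  have "transv (-1) (x - e2) e2 = x" by (simp add: transv_def xe2)
  then have "(transv (-1) (x - e2) \<circ> transv t f2 \<circ> g) e = x"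
    using T1e by (simp add: e1_def)
  then show ?thesis using T1 T2 g(1) transv_grp_comp by metis
qed

text \<open>Unimodularity of the form on \<open>M\<close> is stated through divisibility, with no
  dual module or basis; the case \<open>g = 0\<close> is nondegeneracy.\<close>

definition unimodular_on :: "'v set \<Rightarrow> bool" where
  "unimodular_on M \<longleftrightarrow>
    (\<forall>x \<in> M. \<forall>g. (\<forall>y \<in> M. g dvd B x y) \<longrightarrow> (\<exists>y \<in> M. x = g *s y))"

text \<open>The rank is measured by systems dual under \<open>B\<close>, with no condition on the
  values \<open>B (e i) (e j)\<close>. This gives an induction measure without bases.\<close>

definition rank_le :: "'v set \<Rightarrow> nat \<Rightarrow> bool" where
  "rank_le M r \<longleftrightarrow> (\<forall>k e f. e ` {..<k} \<subseteq> M \<and> f ` {..<k} \<subseteq> M \<and>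
     (\<forall>i<k. \<forall>j<k. B (e i) (f j) = (if i = j then 1 else 0)) \<longrightarrow> k \<le> r)"

definition pair_compl :: "'v set \<Rightarrow> 'v \<Rightarrow> 'v \<Rightarrow> 'v set" where
  "pair_compl M e f = {x \<in> M. B e x = 0 \<and> B f x = 0}"

lemma subspace_pair_compl: "subspace M \<Longrightarrow> subspace (pair_compl M e f)"
  by (auto simp: pair_compl_def subspace_def B_simps)

text \<open>Correcting \<open>y\<close> by multiples of \<open>e\<close> and \<open>f\<close>
  projects it into the complement without changing \<open>B x y\<close>. Hence a divisor of the
  values of \<open>x\<close> on the complement divides its values on all of
  \<open>M\<close>.\<close>

lemma unimodular_on_pair_compl:
  assumes M: "subspace M" and uni: "unimodular_on M" and e: "e \<in> M" "f \<in> M" "B e f = 1"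
  shows "unimodular_on (pair_compl M e f)"
  unfolding unimodular_on_def
proof (intro ballI allI impI)
  fix x g
  assume x: "x \<in> pair_compl M e f" and dvd: "\<forall>y \<in> pair_compl M e f. g dvd B x y"
  note mem = subspace_add[OF M] subspace_diff[OF M] subspace_scale[OF M] subspace_neg[OF M]
  have fe: "B f e = -1" using e B_skew[of f e] by simp
  have "g dvd B x y" if "y \<in> M" for y
  proof -
    define y' where "y' = y + B f y *s e - B e y *s f"
    have "y' \<in> pair_compl M e f"
      using that e mem fe by (simp add: y'_def pair_compl_def B_simps)
    moreover have "B x y' = B x y"
      using x B_skew[of x e] B_skew[of x f] by (simp add: y'_def pair_compl_def B_simps)
    ultimately show ?thesis using dvd by metis
  qed
  then obtain y where y: "y \<in> M" "x = g *s y"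
    using uni x unfolding unimodular_on_def pair_compl_def by blast
  show "\<exists>y \<in> pair_compl M e f. x = g *s y"
  \<comment> \<open>For nonzero \<open>g\<close> the orthogonality of \<open>y\<close> to
    \<open>e\<close> and \<open>f\<close> follows from that of \<open>x\<close> by cancelling
    \<open>g\<close>; for \<open>g = 0\<close> also \<open>x\<close> is 0, and 0 replaces
    \<open>y\<close>.\<close>
  proof (cases "g = 0")
    case True
    then show ?thesis using y subspace_0[OF subspace_pair_compl[OF M]] by auto
  next
    case False
    then have "y \<in> pair_compl M e f" using x y by (auto simp: pair_compl_def B_simps)
    then show ?thesis using y by blast
  qed
qed

text \<open>A dual system in the complement is lengthened by the pair \<open>e\<close>,
  \<open>f\<close>, appended at index \<open>k\<close>.\<close>

lemma rank_le_pair_compl: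
  assumes rank: "rank_le M r" and e: "e \<in> M" "f \<in> M" "B e f = 1"
  shows "r > 0 \<and> rank_le (pair_compl M e f) (r - 1)"
proof -
  have *: "Suc k \<le> r" if "e' ` {..<k} \<subseteq> pair_compl M e f" "f' ` {..<k} \<subseteq> pair_compl M e f"
    "\<forall>i<k. \<forall>j<k. B (e' i) (f' j) = (if i = j then 1 else 0)" for k e' f'
  proof -
    have 1: "B e (f' j) = 0" if "j < k" for j
      using that \<open>f' ` {..<k} \<subseteq> _\<close> by (auto simp: pair_compl_def)
    have 2: "B (e' j) f = 0" if "j < k" for j
      using that \<open>e' ` {..<k} \<subseteq> _\<close> B_skew[of "e' j" f] by (auto simp: pair_compl_def)
    have "(e'(k := e)) ` {..<Suc k} \<subseteq> M \<and> (f'(k := f)) ` {..<Suc k} \<subseteq> M \<and>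
      (\<forall>i<Suc k. \<forall>j<Suc k. B ((e'(k := e)) i) ((f'(k := f)) j) = (if i = j then 1 else 0))"
      using that e 1 2 by (auto simp: pair_compl_def less_Suc_eq image_subset_iff)
    then show ?thesis using rank unfolding rank_le_def by blast
  qed
  \<comment> \<open>The empty system already extends to one pair, so \<open>r\<close> is positive;
    the two functions given are arbitrary.\<close>
  have "Suc 0 \<le> r" by (rule *[where k = 0 and e' = "\<lambda>_. e" and f' = "\<lambda>_. f"]) simp_all
  moreover have "rank_le (pair_compl M e f) (r - 1)"
    unfolding rank_le_def
  proof (intro allI impI)
    fix k :: nat and e' f' :: "nat \<Rightarrow> 'v"
    assume "e' ` {..<k} \<subseteq> pair_compl M e f \<and> f' ` {..<k} \<subseteq> pair_compl M e f \<and>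
      (\<forall>i<k. \<forall>j<k. B (e' i) (f' j) = (if i = j then 1 else 0))"
    then have "Suc k \<le> r" by (elim conjE) (rule *)
    then show "k \<le> r - 1" by simp
  qed
  ultimately show ?thesis by simp
qed

text \<open>A nonzero value \<open>B x0 y\<close> of least Euclidean size divides all the others.
  Dividing \<open>x0\<close> by it gives \<open>e\<close>, and cancelling it leaves
  \<open>B e y = 1\<close>.\<close>

lemma obtain_hyperbolic_pair:
  assumes M: "subspace M" and uni: "unimodular_on M" and "x0 \<in> M" "x0 \<noteq> 0"
  obtains e f where "e \<in> M" "f \<in> M" "B e f = 1"
proof -
  note mem = subspace_add[OF M] subspace_diff[OF M] subspace_scale[OF M] subspace_neg[OF M]
  have "\<exists>y0 \<in> M. B x0 y0 \<noteq> 0"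
  proof (rule ccontr)
    assume "\<not> ?thesis"
    then have "\<forall>y \<in> M. 0 dvd B x0 y" by simp
    then have "\<exists>y \<in> M. x0 = 0 *s y"
      using uni[unfolded unimodular_on_def, rule_format, OF \<open>x0 \<in> M\<close>, of 0] by simp
    then show False using \<open>x0 \<noteq> 0\<close> by simp
  qed
  then obtain y0 where "y0 \<in> M" "B x0 y0 \<noteq> 0" by blast
  then obtain y where y: "y \<in> M" "B x0 y \<noteq> 0"
    and min: "\<And>y'. y' \<in> M \<Longrightarrow> B x0 y' \<noteq> 0 \<Longrightarrow> euclidean_size (B x0 y) \<le> euclidean_size (B x0 y')"
    using exists_least_iff[of "\<lambda>k. \<exists>y. y \<in> M \<and> B x0 y \<noteq> 0 \<and> k = euclidean_size (B x0 y)"]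
    by (metis linorder_not_less)
  have "B x0 y dvd B x0 z" if "z \<in> M" for z
  proof (rule ccontr)
    assume "\<not> ?thesis"
    then have nz: "B x0 z mod B x0 y \<noteq> 0" by (simp add: mod_eq_0_iff_dvd)
    have "B x0 (z - (B x0 z div B x0 y) *s y) = B x0 z mod B x0 y"
      by (simp add: B_simps minus_div_mult_eq_mod)
    then show False
      using min[of "z - (B x0 z div B x0 y) *s y"] nz mod_size_less[OF y(2), of "B x0 z"]
        that y mem by simp
  qed
  then obtain e where e: "e \<in> M" "x0 = B x0 y *s e"
    using uni \<open>x0 \<in> M\<close> unfolding unimodular_on_def by blast
  have "B x0 y = B x0 y * B e y" by (subst (1) e(2)) (simp add: B_simps)
  then have "B e y = 1" using y(2) by simp
  then show thesis using that e y by blast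
qed

text \<open>Once \<open>\<alpha>\<close> fixes \<open>e\<close>, two transvections that fix \<open>e\<close> carry the image of \<open>f\<close> back to \<open>f\<close>:
  after the first of them the difference \<open>u\<close> to \<open>f\<close> satisfies \<open>B u f = 1\<close>.\<close>

lemma isometry_straighten:
  assumes M: "subspace M" and V: "M \<subseteq> V" "subspace V"
    and iso: "\<And>x y. x \<in> V \<Longrightarrow> y \<in> V \<Longrightarrow> B (\<alpha> x) (\<alpha> y) = B x y"
    and disp: "\<And>x. x \<in> V \<Longrightarrow> \<alpha> x - x \<in> M"
    and e: "e \<in> M" "f \<in> M" "B e f = 1"
  shows "\<exists>h \<in> transv_grp M. h (\<alpha> e) = e \<and> h (\<alpha> f) = f"
proof -
  note mem = subspace_add[OF M] subspace_diff[OF M] subspace_scale[OF M] subspace_neg[OF M]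
  have in_M: "\<alpha> x \<in> M" if "x \<in> M" for x
    using mem(1)[OF disp[of x] that] that V by auto
  have "B (\<alpha> e) (\<alpha> f) = B e f" using iso e V by blast
  then have "B (\<alpha> e) (\<alpha> f) = 1" using e by simp
  from this obtain g where g: "g \<in> transv_grp M" "g (\<alpha> e) = e"
    using transv_grp_transitive[OF M in_M[OF e(1)] in_M[OF e(2)] \<open>B (\<alpha> e) (\<alpha> f) = 1\<close> e] by blast
  define f1 where "f1 = g (\<alpha> f)"
  have "f1 - \<alpha> f \<in> M" unfolding f1_def by (rule transv_grp_displacement[OF M g(1)])
  then have f1: "f1 \<in> M" using mem(1)[OF _ in_M[OF e(2)]] by (metis diff_add_cancel)
  have ef1: "B e f1 = 1"
    using transv_grp_isometry[OF g(1), of "\<alpha> e" "\<alpha> f"] iso[of e f] e V g by (auto simp: f1_def)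
  define s where "s = 1 - B f1 f"
  define u where "u = f1 + s *s e - f"
  have uM: "u \<in> M" using f1 e mem by (simp add: u_def)
  have uf: "B u f = 1" using e by (simp add: u_def B_simps s_def)
  have ue: "B u e = 0" using e ef1 B_skew[of f1 e] B_skew[of f e] by (simp add: u_def B_simps)
  have u_f: "f1 + s *s e = u + f" by (simp add: u_def)
  have "B u (f1 + s *s e) = 1"
    using uf u_f by (simp add: B_simps)
  then have T2f: "transv (-1) u (f1 + s *s e) = f" by (simp add: transv_def u_f)
  have T2e: "transv (-1) u e = e" by (simp add: transv_def ue)
  have T1: "transv s e f1 = f1 + s *s e" "transv s e e = e" by (simp_all add: transv_def ef1 B_self)
  have "transv s e \<in> transv_grp M" "transv (-1) u \<in> transv_grp M"
    using transv_in_grp e uM uf by blast+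
  then have "transv (-1) u \<circ> transv s e \<circ> g \<in> transv_grp M"
    using g transv_grp_comp by blast
  moreover have "(transv (-1) u \<circ> transv s e \<circ> g) (\<alpha> e) = e"
    "(transv (-1) u \<circ> transv s e \<circ> g) (\<alpha> f) = f"
    using g T1 T2e T2f by (simp_all add: f1_def)
  ultimately show ?thesis by blast
qed

text \<open>After a pair in \<open>M\<close> has been straightened, the displacements lie in the
  complement of that pair. \<open>V\<close> stays fixed while \<open>M\<close> shrinks to 0, where
  the displacements vanish.\<close>

theorem isometry_product_of_transvections:
  assumes "subspace M" "M \<subseteq> V" "subspace V" "unimodular_on M" "rank_le M r"
    and "\<And>x y. x \<in> V \<Longrightarrow> y \<in> V \<Longrightarrow> B (\<alpha> x) (\<alpha> y) = B x y"
    and "\<And>x. x \<in> V \<Longrightarrow> \<alpha> x - x \<in> M"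
  shows "\<exists>h \<in> transv_grp M. \<forall>x \<in> V. h (\<alpha> x) = x"
  using assms
proof (induction r arbitrary: M \<alpha> rule: less_induct)
  case (less r)
  note M = less.prems(1) and V = less.prems(2,3) and iso = less.prems(6) and disp = less.prems(7)
  show ?case
  proof (cases "M = {0}")
    case True
    then show ?thesis using disp id_in[of M] by (intro bexI[of _ id]) auto
  next
    case False
    then obtain x0 where "x0 \<in> M" "x0 \<noteq> 0" using subspace_0[OF M] by blast
    then obtain e f where ef: "e \<in> M" "f \<in> M" "B e f = 1"
      using obtain_hyperbolic_pair[OF M less.prems(4)] by metis
    obtain h where h: "h \<in> transv_grp M" "h (\<alpha> e) = e" "h (\<alpha> f) = f"
      using isometry_straighten[OF M V iso disp ef] by blast
    let ?M' = "pair_compl M e f"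
    have rank: "r > 0" "rank_le ?M' (r - 1)"
      using rank_le_pair_compl[OF less.prems(5) ef] by auto
    have sub: "?M' \<subseteq> M" by (auto simp: pair_compl_def)
    have iso': "B (h (\<alpha> x)) (h (\<alpha> y)) = B x y" if "x \<in> V" "y \<in> V" for x y
      using that iso transv_grp_isometry[OF h(1)] by simp
    have disp': "h (\<alpha> x) - x \<in> ?M'" if "x \<in> V" for x
    proof -
      have "(h (\<alpha> x) - \<alpha> x) + (\<alpha> x - x) \<in> M"
        by (intro subspace_add M transv_grp_displacement h disp that)
      \<comment> \<open>The composite fixes \<open>e\<close> and \<open>f\<close>, so invariance of
        \<open>B\<close> makes every displacement orthogonal to both.\<close>
      moreover have "B e (h (\<alpha> x)) = B e x" "B f (h (\<alpha> x)) = B f x"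
        using iso'[of e x] iso'[of f x] h ef V that by auto
      ultimately show ?thesis by (simp add: pair_compl_def B_simps)
    qed
    obtain h' where h': "h' \<in> transv_grp ?M'" "\<forall>x \<in> V. h' (h (\<alpha> x)) = x"
      using less.IH[of "r - 1" ?M' "\<lambda>x. h (\<alpha> x)"] rank sub V subspace_pair_compl[OF M]
        unimodular_on_pair_compl[OF M less.prems(4) ef] iso' disp' by auto
    have "h' \<circ> h \<in> transv_grp M"
      using transv_grp_comp[OF transv_grp_mono[OF sub h'(1)] h(1)] .
    then show ?thesis using h'(2) by (intro bexI[of _ "h' \<circ> h"]) auto
  qed
qed

end

section \<open>Matrices acting on finitely supported functions\<close>

text \<open>Vectors are functions on \<open>nat\<close>, so that a whole type is a module and
  \<open>alternating_form\<close> applies; the value 0 beyond the rows keeps images in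
  \<open>vspace\<close>.\<close>

definition act :: "'a::comm_ring_1 mat \<Rightarrow> (nat \<Rightarrow> 'a) \<Rightarrow> nat \<Rightarrow> 'a" where
  "act A x = (\<lambda>i. if i < dim_row A then \<Sum>j<dim_col A. A $$ (i, j) * x j else 0)"

definition vspace :: "nat \<Rightarrow> (nat \<Rightarrow> 'a::zero) set" where
  "vspace N = {x. \<forall>i\<ge>N. x i = 0}"

definition unit_fun :: "nat \<Rightarrow> nat \<Rightarrow> 'a::zero_neq_one" where
  "unit_fun j = (\<lambda>i. if i = j then 1 else 0)"

definition fscale :: "'a::comm_ring_1 \<Rightarrow> (nat \<Rightarrow> 'a) \<Rightarrow> nat \<Rightarrow> 'a" where
  "fscale a x = (\<lambda>i. a * x i)"

definition form :: "'a::comm_ring_1 mat \<Rightarrow> (nat \<Rightarrow> 'a) \<Rightarrow> (nat \<Rightarrow> 'a) \<Rightarrow> 'a" where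
  "form A x y = (\<Sum>i<dim_row A. x i * act A y i)"

lemma fscale_apply [simp]: "fscale a x i = a * x i"
  by (simp add: fscale_def)

lemma module_fscale: "Modules.module (fscale :: 'a::comm_ring_1 \<Rightarrow> _)"
  by unfold_locales (auto simp: fun_eq_iff algebra_simps)

lemma unit_fun_in_vspace: "j < N \<Longrightarrow> unit_fun j \<in> vspace N"
  by (auto simp: unit_fun_def vspace_def)

lemma act_in_vspace: "A \<in> carrier_mat N M \<Longrightarrow> act A x \<in> vspace N"
  by (auto simp: act_def vspace_def)

lemma act_add: "act A (x + y) = act A x + act A y"
  by (auto simp: act_def fun_eq_iff algebra_simps sum.distrib)

lemma act_scale: "act A (fscale a x) = fscale a (act A x)"
  by (auto simp: act_def fun_eq_iff sum_distrib_left mult.left_commute)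

lemma act_unit_fun:
  "j < dim_col A \<Longrightarrow> act A (unit_fun j) = (\<lambda>i. if i < dim_row A then A $$ (i, j) else 0)"
  by (auto simp: act_def unit_fun_def fun_eq_iff if_distrib[of "\<lambda>x. _ * x"] cong: if_cong)

lemma act_one: "x \<in> vspace N \<Longrightarrow> act (1\<^sub>m N) x = x"
  by (auto simp: act_def vspace_def fun_eq_iff if_distrib[of "\<lambda>x. x * _"] cong: if_cong)

lemma act_mult:
  assumes "A \<in> carrier_mat a b" "C \<in> carrier_mat b c"
  shows "act (A * C) x = act A (act C x)"
proof
  fix i
  have "(\<Sum>j<c. (\<Sum>k<b. A $$ (i, k) * C $$ (k, j)) * x j) =
      (\<Sum>j<c. \<Sum>k<b. A $$ (i, k) * (C $$ (k, j) * x j))"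
    by (simp only: sum_distrib_right mult.assoc)
  also have "\<dots> = (\<Sum>k<b. A $$ (i, k) * (\<Sum>j<c. C $$ (k, j) * x j))"
    by (subst sum.swap) (simp only: sum_distrib_left)
  finally show "act (A * C) x i = act A (act C x) i"
    using assms by (auto simp: act_def scalar_prod_def atLeast0LessThan)
qed

lemma mat_eq_act:
  assumes "A \<in> carrier_mat N M" "C \<in> carrier_mat N M"
    and "\<And>j. j < M \<Longrightarrow> act A (unit_fun j) = act C (unit_fun j)"
  shows "A = C"
proof (rule eq_matI)
  fix i j assume ij: "i < dim_row C" "j < dim_col C"
  then have "act A (unit_fun j) i = act C (unit_fun j) i" using assms(2) by (simp add: assms(3))
  then show "A $$ (i, j) = C $$ (i, j)" using assms(1,2) ij by (simp add: act_unit_fun)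
qed (use assms in auto)

lemma act_adjoint:
  assumes "A \<in> carrier_mat N M"
  shows "(\<Sum>i<N. act A x i * y i) = (\<Sum>j<M. x j * act (A\<^sup>T) y j)"
proof -
  have "(\<Sum>i<N. act A x i * y i) = (\<Sum>i<N. \<Sum>j<M. A $$ (i, j) * x j * y i)"
    using assms by (auto simp: act_def sum_distrib_right intro!: sum.cong)
  also have "\<dots> = (\<Sum>j<M. \<Sum>i<N. A $$ (i, j) * x j * y i)"
    by (rule sum.swap)
  also have "\<dots> = (\<Sum>j<M. x j * act (A\<^sup>T) y j)"
    using assms by (auto simp: act_def sum_distrib_left ac_simps intro!: sum.cong)
  finally show ?thesis .
qed

lemma form_congruence:
  assumes "P \<in> carrier_mat N N" "A \<in> carrier_mat N N"
  shows "form P (act A x) (act A y) = form (A\<^sup>T * P * A) x y"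
proof -
  have "act (A\<^sup>T * P * A) y = act (A\<^sup>T) (act P (act A y))"
    using assms act_mult[of "A\<^sup>T * P" N N A N] act_mult[of "A\<^sup>T" N N P N] by simp
  then show ?thesis
    using assms act_adjoint[OF assms(2)] by (simp add: form_def)
qed

lemma form_unit_fun:
  assumes "A \<in> carrier_mat N N" "i < N" "j < N"
  shows "form A (unit_fun i) (unit_fun j) = A $$ (i, j)"
  using assms by (simp add: form_def act_unit_fun)
    (simp add: unit_fun_def if_distrib[of "\<lambda>x. x * _"] cong: if_cong)

lemma form_skew:
  assumes "A \<in> carrier_mat N N" "A\<^sup>T = - A"
  shows "form A x y = - form A y x"
proof -
  have "act (A\<^sup>T) x i = - act A x i" for i
    using assms by (simp add: act_def sum_negf)
  then show ?thesis
    using assms act_adjoint[OF assms(1), of y x] by (simp add: form_def mult.commute sum_negf)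
qed

lemma double_eq_0:
  fixes a :: "'a::comm_ring_1"
  assumes "(2 :: 'a) dvd 1" "a + a = 0"
  shows "a = 0"
proof -
  obtain k :: 'a where k: "1 = 2 * k" using assms(1) unfolding dvd_def by blast
  have "a = 1 * a" by (rule mult_1[symmetric])
  also have "\<dots> = (2 * k) * a" by (rule arg_cong[OF k])
  also have "\<dots> = k * (a + a)" by (simp only: mult_2 distrib_left distrib_right)
  also have "\<dots> = 0" by (simp only: assms(2) mult_zero_right)
  finally show ?thesis .
qed

text \<open>Skew-symmetry makes twice the value 0, and 2 is a unit.\<close>

lemma form_self:
  fixes A :: "'a::comm_ring_1 mat"
  assumes "(2 :: 'a) dvd 1" "A \<in> carrier_mat N N" "A\<^sup>T = - A"
  shows "form A x x = 0"
proof (rule double_eq_0[OF assms(1)])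
  show "form A x x + form A x x = 0"
    using form_skew[OF assms(2,3), of x x] by (simp only: eq_neg_iff_add_eq_0)
qed

text \<open>If \<open>N < k\<close>, padding \<open>X\<close> with zero columns and \<open>Y\<close>
  with zero rows to size \<open>k\<close> leaves the product unchanged, so a matrix with a zero
  column would have a unit determinant.\<close>

lemma dual_systems_length:
  fixes X Y :: "'a::idom mat"
  assumes "X \<in> carrier_mat k N" "Y \<in> carrier_mat N k" "X * Y = 1\<^sub>m k"
  shows "k \<le> N"
proof (rule ccontr)
  assume "\<not> k \<le> N"
  then have Nk: "N < k" by simp
  define X' where "X' = mat k k (\<lambda>(i, j). if j < N then X $$ (i, j) else 0)"
  define Y' where "Y' = mat k k (\<lambda>(i, j). if i < N then Y $$ (i, j) else 0)"
  have c: "X' \<in> carrier_mat k k" "Y' \<in> carrier_mat k k" by (simp_all add: X'_def Y'_def)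
  have "X' * Y' = X * Y"
  proof (rule eq_matI)
    fix i j assume "i < dim_row (X * Y)" "j < dim_col (X * Y)"
    then have ij: "i < k" "j < k" using assms by auto
    have "(X' * Y') $$ (i, j) = (\<Sum>l<k. if l < N then X $$ (i, l) * Y $$ (l, j) else 0)"
      using ij by (auto simp: X'_def Y'_def scalar_prod_def atLeast0LessThan intro!: sum.cong)
    also have "\<dots> = (\<Sum>l<N. X $$ (i, l) * Y $$ (l, j))"
      using Nk by (intro sum.mono_neutral_cong_right) auto
    also have "\<dots> = (X * Y) $$ (i, j)"
      using ij assms(1,2) by (simp add: scalar_prod_def atLeast0LessThan)
    finally show "(X' * Y') $$ (i, j) = (X * Y) $$ (i, j)" .
  qed (use assms c in auto)
  then have "det X' * det Y' = 1" using assms det_mult[OF c] by simp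
  \<comment> \<open>Column \<open>N\<close> is the first of the zero columns added to
    \<open>X\<close>.\<close>
  moreover have "X' *\<^sub>v unit_vec k N = 0\<^sub>v k"
    using Nk by (intro eq_vecI) (auto simp: X'_def)
  then have "det X' = 0"
    using det_0_iff_vec_prod_zero[OF c(1)] Nk by (auto intro!: exI[of _ "unit_vec k N"])
  ultimately show False by simp
qed

section \<open>Inverses and the general linear group\<close>

lemma invertible_of_det:
  assumes A: "A \<in> carrier_mat N N" and "det A * k = (1 :: 'a::comm_ring_1)"
  obtains A' where "A' \<in> carrier_mat N N" "A * A' = 1\<^sub>m N" "A' * A = 1\<^sub>m N"
proof
  note adj = adj_mat[OF A]
  show "k \<cdot>\<^sub>m adj_mat A \<in> carrier_mat N N" using adj by simp
  show "A * (k \<cdot>\<^sub>m adj_mat A) = 1\<^sub>m N"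
    unfolding mult_smult_distrib[OF A adj(1)] adj(2) using assms(2)
    by (intro eq_matI) (auto simp: mult.commute)
  show "(k \<cdot>\<^sub>m adj_mat A) * A = 1\<^sub>m N"
    unfolding mult_smult_assoc_mat[OF adj(1) A] adj(3) using assms(2)
    by (intro eq_matI) (auto simp: mult.commute)
qed

lemma ring_mat_simps [simp]:
  "carrier (ring_mat ty N b) = carrier_mat N N" "monoid.mult (ring_mat ty N b) = (*)"
  "monoid.one (ring_mat ty N b) = 1\<^sub>m N"
  by (simp_all add: ring_mat_def)

lemma group_GL: "group (GL TYPE('a::comm_ring_1) N)"
proof -
  interpret ring "ring_mat TYPE('a) N ()" by (rule ring_mat)
  show ?thesis unfolding GL_def by (rule units_group)
qed

lemma carrier_GL_iff:
  "A \<in> carrier (GL TYPE('a::comm_ring_1) N) \<longleftrightarrow>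
   A \<in> carrier_mat N N \<and> (\<exists>A' \<in> carrier_mat N N. A * A' = 1\<^sub>m N \<and> A' * A = 1\<^sub>m N)"
  by (auto simp: GL_def units_of_def Units_def)

lemma GL_simps [simp]: "monoid.mult (GL ty N) = (*)" "monoid.one (GL ty N) = 1\<^sub>m N"
  by (simp_all add: GL_def units_of_def)

lemma mat_inv_eq:
  assumes "A \<in> carrier_mat N N" "A' \<in> carrier_mat N N" "A * A' = 1\<^sub>m N" "A' * A = 1\<^sub>m N"
  shows "mat_inv A = (A' :: 'a::comm_ring_1 mat)"
proof -
  interpret ring "ring_mat TYPE('a) N ()" by (rule ring_mat)
  show ?thesis using assms inv_char[of A A'] by (simp add: mat_inv_def)
qed

section \<open>The symplectic group as an isometry group\<close>

locale symplectic_form =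
  fixes \<phi> \<psi> :: "'a::euclidean_ring mat" and N :: nat
  assumes two_unit: "is_unit (2 :: 'a)"
    and phi_carrier: "\<phi> \<in> carrier_mat N N" and psi_carrier: "\<psi> \<in> carrier_mat N N"
    and phi_skew: "\<phi>\<^sup>T = - \<phi>"
    and phi_psi: "\<phi> * \<psi> = 1\<^sub>m N" and psi_phi: "\<psi> * \<phi> = 1\<^sub>m N"
    and N_pos: "0 < N"
begin

abbreviation V where "V \<equiv> vspace N :: (nat \<Rightarrow> 'a) set"
abbreviation B where "B \<equiv> form \<phi>"

sublocale alternating_form fscale B
proof -
  interpret Modules.module "fscale :: 'a \<Rightarrow> _" by (rule module_fscale)
  show "alternating_form fscale B"
    by unfold_locales
      (simp_all add: form_def act_add act_scale sum.distrib sum_distrib_left algebra_simps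
        form_self[OF two_unit phi_carrier phi_skew, unfolded form_def])
qed

lemma subspace_V: "subspace V"
  by (auto simp: subspace_def vspace_def)

lemma act_psi_phi: "x \<in> V \<Longrightarrow> act \<psi> (act \<phi> x) = x"
  using act_mult[OF psi_carrier phi_carrier, of x] by (simp add: psi_phi act_one)

lemma B_unit_fun: "j < N \<Longrightarrow> B (unit_fun j) y = act \<phi> y j"
  using phi_carrier
  by (simp add: form_def unit_fun_def if_distrib[of "\<lambda>x. x * _"] cong: if_cong)

text \<open>Pairing \<open>x\<close> with unit vectors shows that \<open>g\<close> divides every
  coordinate of \<open>act \<phi> x\<close>; applying \<open>\<psi>\<close> to the quotient divides
  \<open>x\<close> itself.\<close>

lemma unimodular_on_V: "unimodular_on V"
  unfolding unimodular_on_def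
proof (intro ballI allI impI)
  fix x g assume x: "x \<in> V" and dvd: "\<forall>y \<in> V. g dvd B x y"
  have "\<exists>c. act \<phi> x j = g * c" for j
  proof (cases "j < N")
    case True
    then have "g dvd B x (unit_fun j)" using dvd unit_fun_in_vspace by blast
    then have "g dvd act \<phi> x j"
      using B_skew[of x "unit_fun j"] by (simp add: B_unit_fun[OF True])
    then show ?thesis by (auto elim: dvdE)
  next
    case False
    then show ?thesis using phi_carrier by (intro exI[of _ 0]) (simp add: act_def)
  qed
  then obtain c where "\<And>j. act \<phi> x j = g * c j" by metis
  then have "act \<phi> x = fscale g c" by (simp add: fun_eq_iff)
  then have "x = fscale g (act \<psi> c)"
    using act_psi_phi[OF x] by (simp add: act_scale)
  then show "\<exists>y \<in> V. x = fscale g y" using act_in_vspace[OF psi_carrier] by blast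
qed

text \<open>With the \<open>e i\<close> as rows and the images of the \<open>f j\<close> under
  \<open>\<phi>\<close> as columns, a dual system becomes a factorization of the identity
  matrix.\<close>

lemma rank_le_V: "rank_le V N"
  unfolding rank_le_def
proof (intro allI impI)
  fix k and e f :: "nat \<Rightarrow> nat \<Rightarrow> 'a"
  assume *: "e ` {..<k} \<subseteq> V \<and> f ` {..<k} \<subseteq> V \<and>
     (\<forall>i<k. \<forall>j<k. B (e i) (f j) = (if i = j then 1 else 0))"
  define X where "X = mat k N (\<lambda>(i, l). e i l)"
  define Y where "Y = mat N k (\<lambda>(l, j). act \<phi> (f j) l)"
  have "X * Y = 1\<^sub>m k"
    using * phi_carrier
    by (intro eq_matI) (auto simp: X_def Y_def scalar_prod_def atLeast0LessThan form_def)
  then show "k \<le> N" by (intro dual_systems_length[of X k N Y]) (simp_all add: X_def Y_def)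
qed

lemma det_phi_unit: "det \<phi> * det \<psi> = 1"
  using det_mult[OF phi_carrier psi_carrier] by (simp add: phi_psi)

text \<open>Taking determinants in the congruence and cancelling the unit \<open>det \<phi>\<close>
  gives \<open>det A * det A = 1\<close>, so \<open>A\<close> is invertible.\<close>

lemma Sp_iff: "A \<in> Sp \<phi> \<longleftrightarrow> A \<in> carrier_mat N N \<and> A\<^sup>T * \<phi> * A = \<phi>"
proof
  assume A: "A \<in> carrier_mat N N \<and> A\<^sup>T * \<phi> * A = \<phi>"
  then have "det A * det \<phi> * det A = det \<phi>"
    using phi_carrier det_mult[of "A\<^sup>T * \<phi>" N A] det_mult[of "A\<^sup>T" N \<phi>] det_transpose[of A N]
    by simp
  then have "(det A * det A) * (det \<phi> * det \<psi>) = det \<phi> * det \<psi>"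
    by (metis mult.assoc mult.commute)
  then have "det A * det A = 1" using det_phi_unit by simp
  then obtain A' where "A' \<in> carrier_mat N N" "A * A' = 1\<^sub>m N" "A' * A = 1\<^sub>m N"
    using invertible_of_det[of A N] A by blast
  then show "A \<in> Sp \<phi>" using A phi_carrier by (auto simp: Sp_def carrier_GL_iff)
qed (use phi_carrier in \<open>auto simp: Sp_def carrier_GL_iff\<close>)

lemma Sp_isometry: "A \<in> Sp \<phi> \<Longrightarrow> B (act A x) (act A y) = B x y"
  using form_congruence[OF phi_carrier] by (simp add: Sp_iff)

lemma isometry_in_Sp:
  assumes A: "A \<in> carrier_mat N N"
    and "\<And>x y. x \<in> V \<Longrightarrow> y \<in> V \<Longrightarrow> B (act A x) (act A y) = B x y"
  shows "A \<in> Sp \<phi>"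
proof -
  have P: "A\<^sup>T * \<phi> * A \<in> carrier_mat N N" using A phi_carrier by auto
  have "(A\<^sup>T * \<phi> * A) $$ (i, j) = \<phi> $$ (i, j)" if "i < N" "j < N" for i j
    using assms(2)[OF unit_fun_in_vspace[OF that(1)] unit_fun_in_vspace[OF that(2)]] that
    by (simp add: form_congruence[OF phi_carrier A] form_unit_fun[OF P] form_unit_fun[OF phi_carrier])
  then have "A\<^sup>T * \<phi> * A = \<phi>" using A phi_carrier by (intro eq_matI) auto
  then show ?thesis using A by (simp add: Sp_iff)
qed

lemma Sp_carrier: "A \<in> Sp \<phi> \<Longrightarrow> A \<in> carrier_mat N N"
  by (simp add: Sp_iff)

lemma Sp_mult: "A \<in> Sp \<phi> \<Longrightarrow> C \<in> Sp \<phi> \<Longrightarrow> A * C \<in> Sp \<phi>"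
  by (rule isometry_in_Sp)
    (simp_all add: Sp_isometry act_mult[OF Sp_carrier Sp_carrier] mult_carrier_mat[OF Sp_carrier Sp_carrier])

lemma group_Sp: "group (Sp_group \<phi>)"
proof -
  let ?G = "GL TYPE('a) N"
  interpret G: group ?G by (rule group_GL)
  have GL: "A \<in> carrier ?G" if "A \<in> Sp \<phi>" for A
    using that phi_carrier by (simp add: Sp_def)
  have inv: "inv\<^bsub>?G\<^esub> A \<in> Sp \<phi>" if "A \<in> Sp \<phi>" for A
  proof (rule isometry_in_Sp)
    let ?A' = "inv\<^bsub>?G\<^esub> A"
    show A': "?A' \<in> carrier_mat N N"
      using G.inv_closed[OF GL[OF that]] by (simp add: carrier_GL_iff)
    have "act A (act ?A' x) = x" if "x \<in> V" for x
      using G.r_inv[OF GL[OF \<open>A \<in> Sp \<phi>\<close>]] act_mult[OF Sp_carrier[OF \<open>A \<in> Sp \<phi>\<close>] A', of x]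
        act_one[OF that] by simp
    then show "B (act ?A' x) (act ?A' y) = B x y" if "x \<in> V" "y \<in> V" for x y
      using Sp_isometry[OF \<open>A \<in> Sp \<phi>\<close>, of "act ?A' x" "act ?A' y"] that by simp
  qed
  have "subgroup (Sp \<phi>) ?G"
  proof
    show "\<one>\<^bsub>?G\<^esub> \<in> Sp \<phi>" using phi_carrier by (simp add: Sp_iff)
  qed (use GL inv Sp_mult in auto)
  then show ?thesis
    using subgroup.subgroup_is_group[OF _ G.is_group] phi_carrier by (simp add: Sp_group_def)
qed

lemma Sp_group_simps [simp]:
  "carrier (Sp_group \<phi>) = Sp \<phi>" "monoid.mult (Sp_group \<phi>) = (*)" "monoid.one (Sp_group \<phi>) = 1\<^sub>m N"
  using phi_carrier by (simp_all add: Sp_group_def)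

end

section \<open>Transvections in the elementary symplectic group\<close>

text \<open>The blocks are indexed from 0 while the tail starts at coordinate 1, hence the shift by
  \<open>Suc\<close>.\<close>

definition tail_col :: "nat \<Rightarrow> (nat \<Rightarrow> 'a) \<Rightarrow> 'a mat" where
  "tail_col m u = mat m 1 (\<lambda>(i, j). u (Suc i))"

lemma tail_col_carrier [simp]: "tail_col m u \<in> carrier_mat m 1"
  by (simp add: tail_col_def)

lemma tail_col_surj:
  assumes "v \<in> carrier_mat m 1"
  obtains u where "u \<in> vspace (Suc m)" "u 0 = 0" "v = tail_col m u"
proof
  let ?u = "\<lambda>i. if i = 0 \<or> i > m then 0 else v $$ (i - 1, 0)"
  show "?u \<in> vspace (Suc m)" "?u 0 = 0" by (auto simp: vspace_def)
  show "v = tail_col m ?u"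
    using assms by (intro eq_matI) (auto simp: tail_col_def less_Suc_eq)
qed

context symplectic_form
begin

abbreviation e0 where "e0 \<equiv> unit_fun 0 :: nat \<Rightarrow> 'a"

text \<open>The vector dual to \<open>e0\<close>: the first row of \<open>\<psi> = \<phi>\<^sup>-\<^sup>1\<close>, that is \<open>(0, d)\<close> in block notation.\<close>

definition w0 :: "nat \<Rightarrow> 'a" where
  "w0 = (\<lambda>i. if i < N then \<psi> $$ (0, i) else 0)"

lemma mat_inv_phi: "mat_inv \<phi> = \<psi>"
  by (rule mat_inv_eq[OF phi_carrier psi_carrier phi_psi psi_phi])

lemma e0_in_V: "e0 \<in> V" by (rule unit_fun_in_vspace[OF N_pos])

lemma w0_in_V: "w0 \<in> V" by (auto simp: w0_def vspace_def)

text \<open>As \<open>w0\<close> is the first row of \<open>\<psi>\<close>, the pairing computes the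
  first coordinate of \<open>\<psi>\<close> applied to \<open>act \<phi> x\<close>.\<close>

lemma B_w0: "x \<in> V \<Longrightarrow> B w0 x = x 0"
proof -
  assume x: "x \<in> V"
  have "B w0 x = act \<psi> (act \<phi> x) 0"
    using N_pos phi_carrier psi_carrier by (simp add: form_def w0_def act_def)
  then show ?thesis using act_psi_phi[OF x] by simp
qed

lemma w0_0: "w0 0 = 0"
  using B_w0[OF w0_in_V] B_self by simp

lemma phi_diag: "i < N \<Longrightarrow> \<phi> $$ (i, i) = 0"
  using form_unit_fun[OF phi_carrier, of i i] B_self by simp

lemma B_expand: "B x y = (\<Sum>i<N. \<Sum>j<N. x i * \<phi> $$ (i, j) * y j)"
  using phi_carrier by (simp add: form_def act_def sum_distrib_left mult.assoc)

lemma B_e0_right: "B x e0 = (\<Sum>i<N. x i * \<phi> $$ (i, 0))"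
  using phi_carrier N_pos by (simp add: form_def act_unit_fun)

section \<open>The generators as linear maps\<close>

lemma block_simps:
  "dim_row (c_block \<phi>) = N - 1" "dim_col (c_block \<phi>) = 1"
  "dim_row (d_block \<phi>) = N - 1" "dim_col (d_block \<phi>) = 1"
  "dim_row (nu_block \<phi>) = N - 1" "dim_col (nu_block \<phi>) = N - 1"
  "dim_row (mu_block \<phi>) = N - 1" "dim_col (mu_block \<phi>) = N - 1"
  "i < N - 1 \<Longrightarrow> c_block \<phi> $$ (i, 0) = \<phi> $$ (Suc i, 0)"
  "i < N - 1 \<Longrightarrow> d_block \<phi> $$ (i, 0) = \<psi> $$ (0, Suc i)"
  "i < N - 1 \<Longrightarrow> j < N - 1 \<Longrightarrow> nu_block \<phi> $$ (i, j) = \<phi> $$ (Suc i, Suc j)"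
  "i < N - 1 \<Longrightarrow> j < N - 1 \<Longrightarrow> mu_block \<phi> $$ (i, j) = \<psi> $$ (Suc i, Suc j)"
  using phi_carrier psi_carrier
  by (simp_all add: c_block_def d_block_def nu_block_def mu_block_def split_block_def Let_def mat_inv_phi)

lemma sum_shift: "(\<Sum>i<N. f i) = f 0 + (\<Sum>i<N - 1. f (Suc i))" for f :: "nat \<Rightarrow> 'a"
  using N_pos by (cases N) (simp_all add: sum.lessThan_Suc_shift del: sum.lessThan_Suc)

lemma C_mat_carrier: "v \<in> carrier_mat (N - 1) 1 \<Longrightarrow> C_mat \<phi> v \<in> carrier_mat N N"
  using N_pos phi_carrier block_simps by (auto simp: C_mat_def sp_alpha_def)

lemma R_mat_carrier: "v \<in> carrier_mat (N - 1) 1 \<Longrightarrow> R_mat \<phi> v \<in> carrier_mat N N"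
  using N_pos phi_carrier block_simps by (auto simp: R_mat_def sp_beta_def)

definition C_gen :: "(nat \<Rightarrow> 'a) \<Rightarrow> 'a mat" where
  "C_gen u = C_mat \<phi> (tail_col (N - 1) u)"

definition R_gen :: "(nat \<Rightarrow> 'a) \<Rightarrow> 'a mat" where
  "R_gen u = R_mat \<phi> (tail_col (N - 1) u)"

lemma C_gen_carrier: "C_gen u \<in> carrier_mat N N"
  unfolding C_gen_def by (intro C_mat_carrier tail_col_carrier)

lemma R_gen_carrier: "R_gen u \<in> carrier_mat N N"
  unfolding R_gen_def by (intro R_mat_carrier tail_col_carrier)

text \<open>The product \<open>d v^t nu\<close> contributes \<open>w0\<close> times the row
  \<open>u^t \<phi>\<close>. The subtracted term clears this contribution in column 0, where the
  block matrix has only 1 and \<open>v\<close>.\<close>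

lemma C_gen_entry:
  assumes "u 0 = 0" "i < N" "j < N"
  shows "C_gen u $$ (i, j) =
    (if i = j then 1 else 0) + (if j = 0 then u i else 0) +
    w0 i * ((\<Sum>l<N. u l * \<phi> $$ (l, j)) - (if j = 0 then \<Sum>l<N. u l * \<phi> $$ (l, 0) else 0))"
proof -
  have s: "(\<Sum>l<N. u l * \<phi> $$ (l, j)) = (\<Sum>l<N - 1. u (Suc l) * \<phi> $$ (Suc l, j))" for j
    using assms(1) by (simp add: sum_shift)
  show ?thesis
  proof (cases i; cases j)
    fix i' j' assume ij: "i = Suc i'" "j = Suc j'"
    then show ?thesis
      using assms N_pos phi_carrier unfolding s
      by (simp add: C_gen_def C_mat_def sp_alpha_def block_simps tail_col_def w0_def scalar_prod_def
        atLeast0LessThan sum_distrib_left mult.assoc)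
  qed (use assms N_pos phi_carrier w0_0 in
      \<open>auto simp: C_gen_def C_mat_def sp_alpha_def block_simps tail_col_def\<close>)
qed

text \<open>Since \<open>x 0 = B w0 x\<close>, this is an Eichler transformation for
  \<open>w0\<close> and \<open>u\<close>; the condition \<open>u 0 = 0\<close> says that
  \<open>u\<close> is orthogonal to \<open>w0\<close>.\<close>

lemma act_C_gen:
  assumes x: "x \<in> V" and u: "u \<in> V" "u 0 = 0"
  shows "act (C_gen u) x =
    x + fscale (x 0) u + fscale (B u x - B u e0 * x 0) w0"
proof
  fix i
  show "act (C_gen u) x i =
    (x + fscale (x 0) u + fscale (B u x - B u e0 * x 0) w0) i"
  proof (cases "i < N")
    case True
    have B: "B u x = (\<Sum>j<N. (\<Sum>l<N. u l * \<phi> $$ (l, j)) * x j)"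
      unfolding B_expand sum_distrib_right by (rule sum.swap)
    have "act (C_gen u) x i =
        (\<Sum>j<N. C_gen u $$ (i, j) * x j)"
      using True C_gen_carrier[of u] by (simp add: act_def)
    also have "\<dots> = (\<Sum>j<N. (if j = i then x j else 0) + (if j = 0 then u i * x j else 0) +
        w0 i * ((\<Sum>l<N. u l * \<phi> $$ (l, j)) * x j) - (if j = 0 then w0 i * (B u e0 * x j) else 0))"
      by (rule sum.cong[OF refl])
        (simp add: C_gen_entry[of u i] u True B_e0_right algebra_simps)
    also have "\<dots> = x i + u i * x 0 + w0 i * B u x - w0 i * (B u e0 * x 0)"
      using True N_pos by (simp add: sum.distrib sum_subtractf B sum_distrib_left)
    finally show ?thesis by (simp add: algebra_simps)
  next
    case False
    then show ?thesis
      using x u w0_in_V C_gen_carrier[of u] by (simp add: act_def vspace_def)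
  qed
qed

text \<open>The product \<open>mu v c^t\<close> contributes \<open>act \<psi> u\<close> times the
  first column of \<open>\<phi>\<close>. The subtracted term clears row 0, and
  \<open>\<phi> $$ (0, 0) = 0\<close> keeps column 0 right.\<close>

lemma R_gen_entry:
  assumes "u 0 = 0" "i < N" "j < N"
  shows "R_gen u $$ (i, j) =
    (if i = j then 1 else 0) + (if i = 0 then u j else 0) +
    (act \<psi> u i - (if i = 0 then act \<psi> u 0 else 0)) * \<phi> $$ (j, 0)"
proof -
  have s: "act \<psi> u i = (\<Sum>l<N - 1. \<psi> $$ (i, Suc l) * u (Suc l))"
    using assms psi_carrier by (simp add: act_def sum_shift)
  show ?thesis
  proof (cases i; cases j)
    fix i' j' assume ij: "i = Suc i'" "j = Suc j'"
    then show ?thesis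
      using assms N_pos phi_carrier unfolding s
      by (simp add: R_gen_def R_mat_def sp_beta_def block_simps tail_col_def scalar_prod_def
        atLeast0LessThan)
  qed (use assms N_pos phi_carrier phi_diag in
      \<open>auto simp: R_gen_def R_mat_def sp_beta_def block_simps tail_col_def\<close>)
qed

text \<open>Writing the parameter as \<open>act \<phi> W\<close> turns all products into values of
  \<open>B\<close>: \<open>v^t x\<close> becomes \<open>B x W\<close>, \<open>c^t x\<close> becomes
  \<open>B x e0\<close>, and \<open>mu v\<close> becomes the tail of \<open>W\<close>.\<close>

lemma act_R_gen:
  assumes x: "x \<in> V" and W: "W \<in> V" "B e0 W = 0"
  shows "act (R_gen (act \<phi> W)) x =
    x + fscale (B x W - W 0 * B x e0) e0 + fscale (B x e0) W"
proof
  define u where "u = act \<phi> W"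
  have u0: "u 0 = 0" using W B_unit_fun[OF N_pos, of W] by (simp add: u_def)
  have u: "act \<psi> u = W" using act_psi_phi[OF W(1)] by (simp add: u_def)
  fix i
  show "act (R_gen (act \<phi> W)) x i =
    (x + fscale (B x W - W 0 * B x e0) e0 + fscale (B x e0) W) i"
  proof (cases "i < N")
    case True
    have B: "B x W = (\<Sum>j<N. u j * x j)"
      using phi_carrier by (simp add: form_def u_def mult.commute)
    have B0: "B x e0 = (\<Sum>j<N. \<phi> $$ (j, 0) * x j)"
      by (simp add: B_e0_right mult.commute)
    have "act (R_gen u) x i =
        (\<Sum>j<N. R_gen u $$ (i, j) * x j)"
      using True R_gen_carrier[of u] by (simp add: act_def)
    also have "\<dots> = (\<Sum>j<N. (if j = i then x j else 0) + e0 i * (u j * x j) +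
        (W i - W 0 * e0 i) * (\<phi> $$ (j, 0) * x j))"
      by (rule sum.cong[OF refl])
        (simp add: R_gen_entry[of u i, OF u0] u True unit_fun_def algebra_simps)
    also have "\<dots> = x i + e0 i * B x W + (W i - W 0 * e0 i) * B x e0"
      using True by (simp add: sum.distrib B B0 sum_distrib_left)
    finally show ?thesis by (simp add: algebra_simps u_def)
  next
    case False
    then show ?thesis
      using x W e0_in_V R_gen_carrier[of u]
      by (simp add: act_def vspace_def u_def)
  qed
qed

lemma C_mat_in_Sp:
  assumes "v \<in> carrier_mat (N - 1) 1"
  shows "C_mat \<phi> v \<in> Sp \<phi>"
proof -
  obtain u where u: "u \<in> V" "u 0 = 0" "v = tail_col (N - 1) u"
    using tail_col_surj[OF assms] N_pos by auto
  have C: "C_mat \<phi> v = C_gen u" by (simp only: C_gen_def u(3))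
  have "B (act (C_mat \<phi> v) x) (act (C_mat \<phi> v) y) = B x y" if "x \<in> V" "y \<in> V" for x y
    using that B_w0[of x] B_w0[of y] B_w0[OF u(1)] u(2) B_skew[of x w0] B_skew[of x u]
      B_skew[of u w0]
    by (simp add: C act_C_gen[OF _ u(1,2)] B_simps algebra_simps)
  then show ?thesis by (rule isometry_in_Sp[OF C_mat_carrier[OF assms]])
qed

lemma tail_col_act_phi:
  assumes "v \<in> carrier_mat (N - 1) 1"
  obtains W where "W \<in> V" "B e0 W = 0" "v = tail_col (N - 1) (act \<phi> W)"
proof -
  obtain u where u: "u \<in> V" "u 0 = 0" "v = tail_col (N - 1) u"
    using tail_col_surj[OF assms] N_pos by auto
  have "act \<phi> (act \<psi> u) = u"
    using act_mult[OF phi_carrier psi_carrier, of u] by (simp add: phi_psi act_one[OF u(1)])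
  then show thesis
    using that[of "act \<psi> u"] u act_in_vspace[OF psi_carrier] B_unit_fun[OF N_pos] by simp
qed

lemma R_mat_in_Sp:
  assumes "v \<in> carrier_mat (N - 1) 1"
  shows "R_mat \<phi> v \<in> Sp \<phi>"
proof -
  obtain W where W: "W \<in> V" "B e0 W = 0" "v = tail_col (N - 1) (act \<phi> W)"
    using tail_col_act_phi[OF assms] .
  have R: "R_mat \<phi> v = R_gen (act \<phi> W)" by (simp only: R_gen_def W(3))
  have "B (act (R_mat \<phi> v) x) (act (R_mat \<phi> v) y) = B x y" if "x \<in> V" "y \<in> V" for x y
    using that W(2) B_skew[of e0 y] B_skew[of W y] B_skew[of W e0]
    by (simp add: R act_R_gen[OF _ W(1,2)] B_simps algebra_simps)
  then show ?thesis by (rule isometry_in_Sp[OF R_mat_carrier[OF assms]])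
qed

section \<open>The elementary symplectic group and its action on vectors\<close>

lemma ESp_subgroup: "subgroup (ESp \<phi>) (Sp_group \<phi>)"
  using phi_carrier C_mat_in_Sp R_mat_in_Sp unfolding ESp_def
  by (intro group.generate_is_subgroup[OF group_Sp]) auto

lemma ESp_subset_Sp: "ESp \<phi> \<subseteq> Sp \<phi>"
  using subgroup.subset[OF ESp_subgroup] by simp

lemma ESp_one: "1\<^sub>m N \<in> ESp \<phi>"
  using subgroup.one_closed[OF ESp_subgroup] by simp

lemma ESp_mult: "A \<in> ESp \<phi> \<Longrightarrow> C \<in> ESp \<phi> \<Longrightarrow> A * C \<in> ESp \<phi>"
  using subgroup.m_closed[OF ESp_subgroup] by simp

lemma ESp_carrier: "A \<in> ESp \<phi> \<Longrightarrow> A \<in> carrier_mat N N"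
  using ESp_subset_Sp Sp_carrier by blast

lemma ESp_inverse:
  assumes "A \<in> ESp \<phi>"
  obtains A' where "A' \<in> ESp \<phi>" "A * A' = 1\<^sub>m N" "A' * A = 1\<^sub>m N"
proof
  interpret group "Sp_group \<phi>" by (rule group_Sp)
  have A: "A \<in> carrier (Sp_group \<phi>)" using assms ESp_subset_Sp by auto
  show "inv\<^bsub>Sp_group \<phi>\<^esub> A \<in> ESp \<phi>" using subgroup.m_inv_closed[OF ESp_subgroup assms] .
  show "A * inv\<^bsub>Sp_group \<phi>\<^esub> A = 1\<^sub>m N" "inv\<^bsub>Sp_group \<phi>\<^esub> A * A = 1\<^sub>m N"
    using r_inv[OF A] l_inv[OF A] by simp_all
qed

lemma C_gen_in_ESp: "C_gen u \<in> ESp \<phi>"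
  unfolding ESp_def C_gen_def using phi_carrier
  by (intro generate.incl UnI1 imageI) (auto simp: tail_col_def)

lemma R_gen_in_ESp: "R_gen u \<in> ESp \<phi>"
  unfolding ESp_def R_gen_def using phi_carrier
  by (intro generate.incl UnI2 imageI) (auto simp: tail_col_def)

lemma act_ESp_mult: "A \<in> ESp \<phi> \<Longrightarrow> C \<in> ESp \<phi> \<Longrightarrow> act (A * C) x = act A (act C x)"
  using act_mult ESp_carrier by blast

text \<open>For the parameter \<open>t w0\<close> all terms of the Eichler transformation are
  multiples of \<open>w0\<close>; they add up to \<open>t * x 0\<close> because
  \<open>B w0 e0 = 1\<close>.\<close>

lemma transv_w0_in_ESp: "\<exists>A \<in> ESp \<phi>. \<forall>x \<in> V. act A x = transv t w0 x"
proof (intro bexI ballI)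
  fix x assume x: "x \<in> V"
  have "fscale t w0 \<in> V" using subspace_scale[OF subspace_V w0_in_V] .
  then show "act (C_gen (fscale t w0)) x = transv t w0 x"
    using x B_w0[OF e0_in_V]
    by (simp add: act_C_gen w0_0 transv_def B_simps B_w0 unit_fun_def fun_eq_iff)
qed (rule C_gen_in_ESp)

text \<open>With \<open>W = - t e0\<close> the coefficient of the \<open>e0\<close> term cancels.
  What remains is \<open>- t * B x e0\<close>, which is \<open>t * B e0 x\<close>; this explains the
  sign in the witness.\<close>

lemma transv_e0_in_ESp: "\<exists>A \<in> ESp \<phi>. \<forall>x \<in> V. act A x = transv t e0 x"
proof (intro bexI ballI)
  fix x assume x: "x \<in> V"
  have "fscale (- t) e0 \<in> V" using subspace_scale[OF subspace_V e0_in_V] .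
  then show "act (R_gen (act \<phi> (fscale (- t) e0))) x = transv t e0 x"
    using x B_skew[of x e0]
    by (simp add: act_R_gen transv_def B_simps unit_fun_def fun_eq_iff)
qed (rule R_gen_in_ESp)

lemma act_ESp_in_V: "A \<in> ESp \<phi> \<Longrightarrow> act A x \<in> V"
  using act_in_vspace ESp_carrier by blast

text \<open>Transvections at \<open>w0\<close> change \<open>B e0 x\<close> by multiples of
  \<open>x 0\<close>, and those at \<open>e0\<close> change \<open>x 0\<close> by multiples of
  \<open>B e0 x\<close>, so the Euclidean algorithm runs on these two values.\<close>

lemma ESp_kill_first_coordinate:
  assumes "x \<in> V"
  shows "\<exists>A \<in> ESp \<phi>. act A x 0 = 0"
  using assms
proof (induction "euclidean_size (x 0)" arbitrary: x rule: less_induct)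
  case less
  note x = \<open>x \<in> V\<close>
  define a b where "a = B e0 x" and "b = x 0"
  have *: "\<exists>A \<in> ESp \<phi>. act A x 0 = b + s * (a - t * b) \<and>
    B e0 (act A x) = a - t * b" for s t
  proof -
    obtain A1 where A1: "A1 \<in> ESp \<phi>" "act A1 x = transv t w0 x"
      using transv_w0_in_ESp x by blast
    obtain A2 where A2: "A2 \<in> ESp \<phi>" "act A2 (act A1 x) = transv s e0 (act A1 x)"
      using transv_e0_in_ESp act_ESp_in_V[OF A1(1)] by blast
    have "B e0 (act A1 x) = a - t * b"
      using B_skew[of e0 w0] B_w0[OF e0_in_V]
      by (simp add: A1(2) transv_def B_simps B_w0[OF x] a_def b_def unit_fun_def)
    moreover have "act A1 x 0 = b" by (simp add: A1(2) transv_def w0_0 b_def)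
    ultimately show ?thesis
      using A1 A2 ESp_mult
      by (intro bexI[of _ "A2 * A1"]) (simp_all add: act_ESp_mult transv_def B_simps unit_fun_def)
  qed
  show ?case
  proof (cases "b = 0")
    case True
    then show ?thesis using ESp_one by (intro bexI[of _ "1\<^sub>m N"]) (simp_all add: act_one[OF x] b_def)
  next
    case b: False
    show ?thesis
    proof (cases "a mod b = 0")
      case True
      \<comment> \<open>Taking the quotient one too small leaves \<open>b\<close> rather than 0 as
        the second value, and this \<open>b\<close> can then be subtracted from the first
        coordinate.\<close>
      then have "a - (a div b - 1) * b = b"
        using minus_div_mult_eq_mod[of a b] by (simp add: algebra_simps)
      then show ?thesis using *[of "-1" "a div b - 1"] by auto
    next
      case False
      obtain A where A: "A \<in> ESp \<phi>"
        "act A x 0 = b + (- (b div (a mod b))) * (a - (a div b) * b)"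
        using * by blast
      then have "act A x 0 = b mod (a mod b)"
        by (simp add: minus_div_mult_eq_mod)
      then have "euclidean_size (act A x 0) < euclidean_size (x 0)"
        using mod_size_less[OF False, of b] mod_size_less[OF b, of a] by (simp add: b_def)
      then obtain C where "C \<in> ESp \<phi>" "act C (act A x) 0 = 0"
        using less.hyps act_ESp_in_V[OF A(1)] by blast
      then show ?thesis
        using A(1) ESp_mult by (intro bexI[of _ "C * A"]) (simp_all add: act_ESp_mult)
    qed
  qed
qed

text \<open>A vector with first coordinate 1 is the image of \<open>e0\<close> under one
  \<open>C_gen\<close>. So \<open>x\<close> is first moved to first coordinate 0, then by one
  \<open>R_gen\<close> to first coordinate 1.\<close>

lemma ESp_transitive:
  assumes x: "x \<in> V" "z \<in> V" "B x z = 1"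
  shows "\<exists>A \<in> ESp \<phi>. act A e0 = x"
proof -
  obtain A1 where A1: "A1 \<in> ESp \<phi>" "act A1 x 0 = 0"
    using ESp_kill_first_coordinate[OF x(1)] by blast
  define x1 z1 where "x1 = act A1 x" and "z1 = act A1 z"
  have x1: "x1 \<in> V" "x1 0 = 0" "z1 \<in> V" "B x1 z1 = 1"
    using A1 act_ESp_in_V[OF A1(1)] Sp_isometry[of A1 x z] ESp_subset_Sp x(3)
    by (auto simp: x1_def z1_def)
  \<comment> \<open>The \<open>w0\<close> term makes \<open>W\<close> orthogonal to
    \<open>e0\<close>; it leaves the value against \<open>x1\<close> at 1 because
    \<open>x1 0 = 0\<close>.\<close>
  define W where "W = z1 + fscale (B e0 z1) w0"
  have B01: "B e0 w0 = -1" using B_skew[of e0 w0] B_w0[OF e0_in_V] by (simp add: unit_fun_def)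
  have W: "W \<in> V" "B e0 W = 0" "B x1 W = 1"
    using subspace_add[OF subspace_V x1(3) subspace_scale[OF subspace_V w0_in_V]]
      B_skew[of x1 w0] B_w0[OF x1(1)] x1 B01
    by (simp_all add: W_def B_simps)
  define A2 where "A2 = R_gen (act \<phi> W)"
  define x2 where "x2 = act A2 x1"
  have A2: "A2 \<in> ESp \<phi>" unfolding A2_def by (rule R_gen_in_ESp)
  have x2_eq: "x2 = x1 + fscale (B x1 W - W 0 * B x1 e0) e0 + fscale (B x1 e0) W"
    unfolding x2_def A2_def by (rule act_R_gen[OF x1(1) W(1,2)])
  have e0_0: "e0 0 = 1" by (simp add: unit_fun_def)
  have "x2 0 = 1" using W x1 e0_0 by (simp add: x2_eq mult.commute)
  then have x2: "x2 \<in> V" "x2 0 = 1" using act_ESp_in_V[OF A2] by (simp_all add: x2_def)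
  define A3 where "A3 = C_gen (x2 - e0)"
  have A3: "A3 \<in> ESp \<phi>" unfolding A3_def by (rule C_gen_in_ESp)
  have u: "x2 - e0 \<in> V" "(x2 - e0) 0 = 0"
    using subspace_diff[OF subspace_V x2(1) e0_in_V] x2 e0_0 by simp_all
  have A3e: "act A3 e0 = x2"
    unfolding A3_def act_C_gen[OF e0_in_V u] by (simp add: e0_0)
  obtain A1' where A1': "A1' \<in> ESp \<phi>" "A1' * A1 = 1\<^sub>m N" using ESp_inverse[OF A1(1)] by metis
  obtain A2' where A2': "A2' \<in> ESp \<phi>" "A2' * A2 = 1\<^sub>m N" using ESp_inverse[OF A2] by metis
  have "act A1' x1 = x"
    using act_ESp_mult[OF A1'(1) A1(1), of x] by (simp add: A1'(2) act_one[OF x(1)] x1_def)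
  moreover have "act A2' x2 = x1"
    using act_ESp_mult[OF A2'(1) A2, of x1] by (simp add: A2'(2) act_one[OF x1(1)] x2_def)
  ultimately have "act (A1' * (A2' * A3)) e0 = x"
    using A1' A2' A3 A3e ESp_mult by (simp add: act_ESp_mult)
  then show ?thesis using A1' A2' A3 ESp_mult by blast
qed

text \<open>Conjugating \<open>transv t e0\<close> by an isometry that sends \<open>e0\<close> to
  \<open>u\<close> gives \<open>transv t u\<close>.\<close>

lemma transv_in_ESp:
  assumes u: "u \<in> V" "v \<in> V" "B u v = 1"
  shows "\<exists>A \<in> ESp \<phi>. \<forall>x \<in> V. act A x = transv t u x"
proof -
  obtain G where G: "G \<in> ESp \<phi>" "act G e0 = u" using ESp_transitive[OF u] by blast
  obtain G' where G': "G' \<in> ESp \<phi>" "G * G' = 1\<^sub>m N" using ESp_inverse[OF G(1)] by metis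
  obtain T where T: "T \<in> ESp \<phi>" "\<And>x. x \<in> V \<Longrightarrow> act T x = transv t e0 x"
    using transv_e0_in_ESp by blast
  have "act (G * (T * G')) x = transv t u x" if "x \<in> V" for x
  proof -
    have x: "act G (act G' x) = x"
      using act_ESp_mult[OF G(1) G'(1), of x] by (simp add: G'(2) act_one[OF that])
    have "B e0 (act G' x) = B u x"
      using Sp_isometry[of G e0 "act G' x"] ESp_subset_Sp G by (auto simp: x)
    then show ?thesis
      using G G' T ESp_mult act_ESp_in_V[OF G'(1), of x]
      by (simp add: act_ESp_mult transv_def act_add act_scale x)
  qed
  then show ?thesis using G G' T ESp_mult by blast
qed

lemma transv_grp_in_ESp:
  assumes "h \<in> transv_grp V"
  shows "\<exists>A \<in> ESp \<phi>. \<forall>x \<in> V. act A x = h x"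
  using assms
proof induction
  case id_in
  then show ?case using ESp_one act_one by (intro bexI[of _ "1\<^sub>m N"]) auto
next
  case (transv_comp h u v t)
  obtain A where A: "A \<in> ESp \<phi>" "\<And>x. x \<in> V \<Longrightarrow> act A x = h x" using transv_comp.IH by blast
  obtain T where T: "T \<in> ESp \<phi>" "\<And>x. x \<in> V \<Longrightarrow> act T x = transv t u x"
    using transv_in_ESp transv_comp.hyps by blast
  have "act (T * A) x = (transv t u \<circ> h) x" if "x \<in> V" for x
    using act_ESp_mult[OF T(1) A(1), of x] T(2)[OF act_ESp_in_V[OF A(1)], of x] A(2)[OF that]
    by simp
  then show ?case using ESp_mult[OF T(1) A(1)] by blast
qed

text \<open>Decomposing with \<open>M = V\<close> gives a product of transvections that undoes
  \<open>A\<close> on \<open>V\<close>. Its matrix \<open>H\<close> is elementary, and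
  \<open>A\<close> is the inverse of \<open>H\<close>.\<close>

lemma Sp_subset_ESp: "Sp \<phi> \<subseteq> ESp \<phi>"
proof
  fix A assume A: "A \<in> Sp \<phi>"
  have Ac: "A \<in> carrier_mat N N" using Sp_carrier[OF A] .
  have "act A x - x \<in> V" if "x \<in> V" for x
    using subspace_diff[OF subspace_V act_in_vspace[OF Ac] that] .
  then obtain h where h: "h \<in> transv_grp V" "\<forall>x \<in> V. h (act A x) = x"
    using isometry_product_of_transvections[OF subspace_V subset_refl subspace_V unimodular_on_V
        rank_le_V, of "act A"] Sp_isometry[OF A] by blast
  obtain H where H: "H \<in> ESp \<phi>" "\<forall>x \<in> V. act H x = h x" using transv_grp_in_ESp[OF h(1)] by blast
  have Hc: "H \<in> carrier_mat N N" using ESp_carrier[OF H(1)] .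
  have "H * A = 1\<^sub>m N"
  proof (rule mat_eq_act)
    fix j assume "j < N"
    then have "unit_fun j \<in> V" by (rule unit_fun_in_vspace)
    then show "act (H * A) (unit_fun j) = act (1\<^sub>m N) (unit_fun j)"
      using act_mult[OF Hc Ac] act_one h(2) H(2) act_in_vspace[OF Ac] by metis
  qed (use Hc Ac in auto)
  moreover obtain H' where H': "H' \<in> ESp \<phi>" "H' * H = 1\<^sub>m N" using ESp_inverse[OF H(1)] by metis
  ultimately have "A = H'"
    using assoc_mult_mat[OF ESp_carrier[OF H'(1)] Hc Ac] Ac ESp_carrier[OF H'(1)] by simp
  then show "A \<in> ESp \<phi>" using H' by simp
qed

end

section \<open>A matrix of Pfaffian one is invertible\<close>

definition matchings :: "nat \<Rightarrow> (nat \<Rightarrow> nat) set" where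
  "matchings n = {p. p permutes {0..<2 * n} \<and> (\<forall>i<n. p (2 * i) < p (2 * i + 1)) \<and>
     (\<forall>i<n. \<forall>j<n. i < j \<longrightarrow> p (2 * i) < p (2 * j))}"

definition pf_term :: "nat \<Rightarrow> (nat \<Rightarrow> nat \<Rightarrow> 'a::comm_ring_1) \<Rightarrow> (nat \<Rightarrow> nat) \<Rightarrow> 'a" where
  "pf_term n A p = signof p * (\<Prod>i<n. A (p (2 * i)) (p (2 * i + 1)))"

definition pf :: "nat \<Rightarrow> (nat \<Rightarrow> nat \<Rightarrow> 'a::comm_ring_1) \<Rightarrow> 'a" where
  "pf n A = (\<Sum>p\<in>matchings n. pf_term n A p)"

text \<open>Nothing is required on the diagonal, which does not enter \<^const>\<open>pf\<close>.\<close>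

definition skew_fun :: "(nat \<Rightarrow> nat \<Rightarrow> 'a::comm_ring_1) \<Rightarrow> bool" where
  "skew_fun A \<longleftrightarrow> (\<forall>i j. i \<noteq> j \<longrightarrow> A i j = - A j i)"

definition block_swap :: "nat \<Rightarrow> nat \<Rightarrow> nat \<Rightarrow> nat" where
  "block_swap a b = transpose (2 * a) (2 * b) \<circ> transpose (2 * a + 1) (2 * b + 1)"

text \<open>Two permutations are related when they list the same perfect matching.\<close>

inductive regroup :: "nat \<Rightarrow> (nat \<Rightarrow> nat) \<Rightarrow> (nat \<Rightarrow> nat) \<Rightarrow> bool" for n where
  base: "p permutes {0..<2 * n} \<Longrightarrow> regroup n p p"
| flip: "regroup n p q \<Longrightarrow> i < n \<Longrightarrow> regroup n p (q \<circ> transpose (2 * i) (2 * i + 1))"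
| swap: "regroup n p q \<Longrightarrow> a < b \<Longrightarrow> b < n \<Longrightarrow> regroup n p (q \<circ> block_swap a b)"

text \<open>This is the matching itself, free of order: the invariant preserved by
  \<open>regroup\<close>.\<close>

definition pairs :: "nat \<Rightarrow> (nat \<Rightarrow> nat) \<Rightarrow> nat set set" where
  "pairs n p = (\<lambda>i. {p (2 * i), p (2 * i + 1)}) ` {..<n}"

lemma flip_apply:
  "transpose (2 * i) (2 * i + 1) (2 * j) = (if j = i then 2 * j + 1 else 2 * (j::nat))"
  "transpose (2 * i) (2 * i + 1) (2 * j + 1) = (if j = i then 2 * j else 2 * j + (1::nat))"
  by (auto simp: transpose_def)

lemma block_swap_apply:
  "block_swap a b (2 * j) = 2 * transpose a b j"
  "block_swap a b (2 * j + 1) = 2 * transpose a b j + 1"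
  by (auto simp: block_swap_def transpose_def)

lemma flip_permutes:
  "i < n \<Longrightarrow> transpose (2 * i) (2 * i + 1) permutes {0..<2 * (n::nat)}"
  by (intro permutes_swap_id) auto

lemma block_swap_permutes: "a < n \<Longrightarrow> b < n \<Longrightarrow> block_swap a b permutes {0..<2 * n}"
  unfolding block_swap_def by (intro permutes_compose permutes_swap_id) auto

lemma regroup_permutes:
  assumes "regroup n p q"
  shows "p permutes {0..<2 * n} \<and> q permutes {0..<2 * n}"
  using assms
proof induction
  case (base p)
  then show ?case by simp
next
  case (flip p q i)
  then show ?case using permutes_compose[OF flip_permutes, of i n q] by blast
next
  case (swap p q a b)
  have "block_swap a b permutes {0..<2 * n}" using swap.hyps by (intro block_swap_permutes) auto
  then show ?case using swap.IH permutes_compose by blast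
qed

text \<open>The moves act on positions from the right and \<open>t\<close> acts on values from the
  left, so they commute.\<close>

lemma regroup_comp_left:
  assumes "t permutes {0..<2 * n}" "regroup n p q"
  shows "regroup n (t \<circ> p) (t \<circ> q)"
  using assms(2)
proof induction
  case (base p)
  then show ?case using permutes_compose[OF _ assms(1)] by (blast intro: regroup.base)
next
  case (flip p q i)
  show ?case using regroup.flip[OF flip.IH flip.hyps(2)] unfolding comp_assoc .
next
  case (swap p q a b)
  show ?case using regroup.swap[OF swap.IH swap.hyps(2,3)] unfolding comp_assoc .
qed

lemma prod_swap_block:
  assumes "a < n" "b < n"
  shows "(\<Prod>i<n. f ((q \<circ> block_swap a b) (2 * i)) ((q \<circ> block_swap a b) (2 * i + 1))) =
    (\<Prod>i<n. f (q (2 * i)) (q (2 * i + 1)))"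
proof -
  have "transpose a b permutes {..<n}" using assms by (intro permutes_swap_id) auto
  then have "(\<Prod>i<n. f (q (2 * i)) (q (2 * i + 1))) =
      prod ((\<lambda>i. f (q (2 * i)) (q (2 * i + 1))) \<circ> transpose a b) {..<n}"
    by (rule prod.permute)
  then show ?thesis unfolding o_def block_swap_apply by simp
qed

lemma sign_block_swap: "a \<noteq> b \<Longrightarrow> sign (block_swap a b) = 1"
  unfolding block_swap_def
  by (subst sign_compose) (auto simp: sign_swap_id permutation_swap_id)

text \<open>A flip changes the sign of the permutation and of one factor; a block swap is even and
  merely reorders the factors.\<close>

lemma regroup_pf_term:
  assumes A: "skew_fun A" and "regroup n p q"
  shows "pf_term n A q = pf_term n A p"
  using assms(2)
proof induction
  case (flip p q i)
  let ?t = "transpose (2 * i) (2 * i + 1)"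
  let ?F = "\<lambda>q j. A (q (2 * j)) (q (2 * j + 1))"
  have q: "q permutes {0..<2 * n}" using regroup_permutes[OF flip.hyps(1)] by simp
  have "q (2 * i + 1) \<noteq> q (2 * i)" using permutes_inj[OF q] by (simp add: inj_eq)
  then have "A (q (2 * i + 1)) (q (2 * i)) = - ?F q i"
    using A unfolding skew_fun_def by blast
  then have i: "?F (q \<circ> ?t) i = - ?F q i"
    by (simp only: o_apply flip_apply if_True simp_thms)
  have "(\<Prod>j\<in>{..<n} - {i}. ?F (q \<circ> ?t) j) = (\<Prod>j\<in>{..<n} - {i}. ?F q j)"
    by (rule prod.cong[OF refl]) (simp only: o_apply flip_apply Diff_iff singleton_iff if_False)
  then have "(\<Prod>j<n. ?F (q \<circ> ?t) j) = - (\<Prod>j<n. ?F q j)"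
    using flip.hyps(2) i by (simp add: prod.remove[of "{..<n}" i])
  moreover have "sign (q \<circ> ?t) = - sign q"
    using q permutes_imp_permutation[of "{0..<2 * n}" q]
    by (simp add: sign_compose permutation_swap_id sign_swap_id)
  ultimately have "pf_term n A (q \<circ> ?t) = pf_term n A q"
    unfolding pf_term_def by (simp only: of_int_minus minus_mult_minus)
  then show ?case using flip.IH by (rule trans)
next
  case (swap p q a b)
  have q: "q permutes {0..<2 * n}" using regroup_permutes[OF swap.hyps(1)] by simp
  have "block_swap a b permutes {0..<2 * n}" using swap.hyps by (intro block_swap_permutes) auto
  then have "sign (q \<circ> block_swap a b) = sign q"
    using q swap.hyps permutes_imp_permutation[of "{0..<2 * n}"]
    by (simp add: sign_compose sign_block_swap)
  moreover have "a < n" using swap.hyps by simp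
  ultimately have "pf_term n A (q \<circ> block_swap a b) = pf_term n A q"
    unfolding pf_term_def using prod_swap_block[OF _ swap.hyps(3), of a A q] by (simp only:)
  then show ?case using swap.IH by (rule trans)
qed simp

lemma pairs_flip: "pairs n (q \<circ> transpose (2 * i) (2 * i + 1)) = pairs n q"
proof -
  have "{q (if j = i then 2 * j + 1 else 2 * j), q (if j = i then 2 * j else 2 * j + 1)} =
      {q (2 * j), q (2 * j + 1)}" for j
    by (cases "j = i") auto
  then show ?thesis unfolding pairs_def o_def flip_apply by (simp only:)
qed

lemma pairs_block_swap:
  assumes "a < n" "b < n"
  shows "pairs n (q \<circ> block_swap a b) = pairs n q"
proof -
  have "transpose a b permutes {..<n}" using assms by (intro permutes_swap_id) auto
  then have "transpose a b ` {..<n} = {..<n}" by (rule permutes_image)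
  then have "(\<lambda>i. {q (2 * i), q (2 * i + 1)}) ` {..<n} =
      (\<lambda>i. {q (2 * i), q (2 * i + 1)}) ` (transpose a b ` {..<n})" by (simp only:)
  then show ?thesis
    unfolding pairs_def o_def block_swap_apply image_image by (rule sym)
qed

lemma regroup_pairs:
  assumes "regroup n p q"
  shows "pairs n q = pairs n p"
  using assms
proof induction
  case (flip p q i)
  show ?case using pairs_flip flip.IH by (rule trans)
next
  case (swap p q a b)
  show ?case using pairs_block_swap[of a n b q] swap by (metis less_trans)
qed (rule refl)

text \<open>A listing of a matching that minimises this weight is the canonical one: turning a pair
  around or exchanging two pairs that are out of order decreases it.\<close>

definition weight :: "nat \<Rightarrow> (nat \<Rightarrow> nat) \<Rightarrow> nat" where
  "weight n p = (\<Sum>i<n. (n - i) * p (2 * i))"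

lemma weight_flip:
  assumes "i < n" "q (2 * i + 1) < q (2 * i)"
  shows "weight n (q \<circ> transpose (2 * i) (2 * i + 1)) < weight n q"
  unfolding weight_def o_def flip_apply
proof (rule sum_strict_mono_ex1)
  show "\<exists>j\<in>{..<n}. (n - j) * q (if j = i then 2 * j + 1 else 2 * j) < (n - j) * q (2 * j)"
    using assms by (intro bexI[of _ i]) auto
qed (use assms in auto)

text \<open>This is the rearrangement inequality for two terms: the coefficients
  \<open>n - i\<close> decrease, so moving the smaller value forward lowers the sum.\<close>

lemma weight_block_swap:
  assumes "a < b" "b < n" "q (2 * b) < q (2 * a)"
  shows "weight n (q \<circ> block_swap a b) < weight n q"
proof -
  have split: "(\<Sum>i<n. f i) = f a + (f b + (\<Sum>i\<in>{..<n} - {a} - {b}. f i))" for f :: "nat \<Rightarrow> nat"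
    using assms by (simp add: sum.remove[of "{..<n}" a] sum.remove[of "{..<n} - {a}" b])
  obtain d where d: "n - a = (n - b) + d" "0 < d"
    using assms by (metis diff_less_mono2 less_imp_add_positive less_trans)
  have rest: "(\<Sum>i\<in>{..<n} - {a} - {b}. (n - i) * q (2 * transpose a b i)) =
      (\<Sum>i\<in>{..<n} - {a} - {b}. (n - i) * q (2 * i))"
    by (intro sum.cong) (auto simp: transpose_def)
  have "d * q (2 * b) < d * q (2 * a)" using d assms by simp
  then show ?thesis
    unfolding weight_def o_def block_swap_apply split[of "\<lambda>i. (n - i) * q (2 * i)"]
      split[of "\<lambda>i. (n - i) * q (2 * transpose a b i)"] rest d(1)
    by (simp add: algebra_simps)
qed

text \<open>This turns an arbitrary permutation, such as a transposition composed with a matching,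
  back into an index of the sum \<open>pf\<close>.\<close>

lemma regroup_canonical:
  assumes "p permutes {0..<2 * n}"
  shows "\<exists>q \<in> matchings n. regroup n p q"
proof -
  obtain q where q: "regroup n p q" and min: "\<And>q'. regroup n p q' \<Longrightarrow> weight n q \<le> weight n q'"
    using ex_has_least_nat[of "regroup n p" p "weight n"] regroup.base[OF assms] by blast
  have perm: "q permutes {0..<2 * n}" using regroup_permutes[OF q] by simp
  have neq: "q x \<noteq> q y" if "x \<noteq> y" for x y using permutes_inj[OF perm] that by (simp add: inj_eq)
  have "q (2 * i) < q (2 * i + 1)" if "i < n" for i
    using weight_flip[OF that, of q] min[OF regroup.flip[OF q that]] neq[of "2 * i" "2 * i + 1"]
    by linarith
  moreover have "q (2 * i) < q (2 * j)" if "i < j" "j < n" for i j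
    using weight_block_swap[OF that, of q] min[OF regroup.swap[OF q that]]
      neq[of "2 * i" "2 * j"] that by linarith
  ultimately have "q \<in> matchings n" using perm by (simp add: matchings_def)
  then show ?thesis using q by blast
qed

text \<open>The even positions list the minima of the pairs in increasing order, so the set of pairs
  fixes them; each odd position then holds the partner.\<close>

lemma matchings_determined_by_pairs:
  assumes q: "q \<in> matchings n" "q' \<in> matchings n" and pairs: "pairs n q = pairs n q'"
  shows "q = q'"
proof -
  have ord: "p (2 * i) < p (2 * i + 1)" if "p \<in> matchings n" "i < n" for p i
    using that by (simp add: matchings_def)
  have mins: "Min ` pairs n p = (\<lambda>i. p (2 * i)) ` {..<n}" if "p \<in> matchings n" for p
    unfolding pairs_def image_image
    using ord[OF that] by (intro image_cong) (auto simp: min_def dest: less_imp_le)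
  have sorted: "sorted_wrt (<) (map (\<lambda>i. p (2 * i)) [0..<n])" if "p \<in> matchings n" for p
    using that by (simp add: matchings_def sorted_wrt_iff_nth_less)
  have "map (\<lambda>i. q (2 * i)) [0..<n] = map (\<lambda>i. q' (2 * i)) [0..<n]"
  proof (rule strict_sorted_equal)
    show "set (map (\<lambda>i. q (2 * i)) [0..<n]) = set (map (\<lambda>i. q' (2 * i)) [0..<n])"
      using mins[OF q(1)] mins[OF q(2)] pairs by (simp add: atLeast0LessThan)
  qed (use sorted q in auto)
  then have even: "q (2 * i) = q' (2 * i)" if "i < n" for i
    using that by (simp add: map_eq_conv)
  have odd: "q (2 * i + 1) = q' (2 * i + 1)" if "i < n" for i
  proof -
    have "{q (2 * i), q (2 * i + 1)} \<in> pairs n q'"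
      using that unfolding pairs[symmetric] unfolding pairs_def by blast
    then obtain j where j: "j < n" "{q (2 * i), q (2 * i + 1)} = {q' (2 * j), q' (2 * j + 1)}"
      by (auto simp: pairs_def)
    then have "q (2 * i) = q' (2 * j) \<and> q (2 * i + 1) = q' (2 * j + 1)"
      using ord[OF q(1) that] ord[OF q(2) j(1)] by (auto simp: doubleton_eq_iff)
    moreover have "inj q" using q(1) by (auto simp: matchings_def dest: permutes_inj)
    ultimately have "2 * i = 2 * j" using even[OF j(1)] by (metis injD)
    then show ?thesis using \<open>q (2 * i) = _ \<and> _\<close> by simp
  qed
  show ?thesis
  proof
    fix x
    show "q x = q' x"
    proof (cases "x < 2 * n")
      case True
      then show ?thesis
        using even[of "x div 2"] odd[of "x div 2"] by (cases "even x") (auto elim!: evenE oddE)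
    next
      case False
      then have "x \<notin> {0..<2 * n}" by simp
      moreover have "q permutes {0..<2 * n}" "q' permutes {0..<2 * n}"
        using q by (simp_all add: matchings_def)
      ultimately show ?thesis by (simp add: permutes_not_in)
    qed
  qed
qed

text \<open>The factors are unchanged by the symmetry, and the sign of the permutation
  flips.\<close>

lemma pf_term_transpose:
  assumes sym: "\<And>x y. x \<noteq> y \<Longrightarrow> A (transpose k l x) (transpose k l y) = A x y"
    and "k \<noteq> l" and p: "p permutes {0..<2 * n}"
  shows "pf_term n A (transpose k l \<circ> p) = - pf_term n A p"
proof -
  have "p (2 * i) \<noteq> p (2 * i + 1)" for i using permutes_inj[OF p] by (simp add: inj_eq)
  then have "A ((transpose k l \<circ> p) (2 * i)) ((transpose k l \<circ> p) (2 * i + 1)) =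
      A (p (2 * i)) (p (2 * i + 1))" for i
    using sym by (simp del: One_nat_def)
  moreover have "sign (transpose k l \<circ> p) = - sign p"
    using p assms(2) permutes_imp_permutation[of "{0..<2 * n}" p]
    by (simp add: sign_compose permutation_swap_id sign_swap_id)
  ultimately show ?thesis by (simp add: pf_term_def)
qed

text \<open>The transposition acts on matchings and changes the sign of every term.\<close>

lemma pf_double_eq_0:
  assumes A: "skew_fun A"
    and sym: "\<And>x y. x \<noteq> y \<Longrightarrow> A (transpose k l x) (transpose k l y) = A x y"
    and kl: "k \<noteq> l" "k < 2 * n" "l < 2 * n"
  shows "pf n A + pf n A = 0"
proof -
  let ?t = "transpose k l"
  have t: "?t permutes {0..<2 * n}" using kl by (intro permutes_swap_id) auto
  have perm: "p permutes {0..<2 * n}" if "p \<in> matchings n" for p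
    using that by (simp add: matchings_def)
  have "\<forall>p \<in> matchings n. \<exists>q. q \<in> matchings n \<and> regroup n (?t \<circ> p) q"
    using regroup_canonical permutes_compose[OF perm t] by blast
  then obtain g where g: "\<And>p. p \<in> matchings n \<Longrightarrow> g p \<in> matchings n"
    "\<And>p. p \<in> matchings n \<Longrightarrow> regroup n (?t \<circ> p) (g p)"
    by metis
  \<comment> \<open>Applying \<open>?t\<close> to both listings of the matching of
    \<open>?t \<circ> p\<close> leads back to the pairs of \<open>p\<close>, so \<open>g\<close> is
    an involution.\<close>
  have gg: "g (g p) = p" if p: "p \<in> matchings n" for p
  proof (rule matchings_determined_by_pairs[OF g(1)[OF g(1)[OF p]] p])
    have "regroup n (?t \<circ> (?t \<circ> p)) (?t \<circ> g p)" using regroup_comp_left[OF t g(2)[OF p]] .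
    then have "pairs n (?t \<circ> g p) = pairs n p"
      using regroup_pairs by (simp flip: comp_assoc)
    then show "pairs n (g (g p)) = pairs n p" using regroup_pairs[OF g(2)[OF g(1)[OF p]]] by simp
  qed
  \<comment> \<open>A matching containing the pair of \<open>k\<close> and \<open>l\<close> is fixed
    by \<open>g\<close>, so the sum is reindexed and compared with its negative instead of being
    cancelled in pairs.\<close>
  have "pf n A = (\<Sum>p\<in>matchings n. pf_term n A (g p))"
    unfolding pf_def by (rule sum.reindex_bij_witness[of _ g g]) (auto simp: g gg)
  also have "\<dots> = (\<Sum>p\<in>matchings n. - pf_term n A p)"
    using regroup_pf_term[OF A g(2)] pf_term_transpose[of A k l, OF sym kl(1) perm]
    by (intro sum.cong) auto
  finally show ?thesis by (simp add: pf_def sum_negf)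
qed

section \<open>Linearity of the Pfaffian in one row\<close>

definition replace_row ::
    "(nat \<Rightarrow> nat \<Rightarrow> 'a::comm_ring_1) \<Rightarrow> nat \<Rightarrow> (nat \<Rightarrow> 'a) \<Rightarrow> nat \<Rightarrow> nat \<Rightarrow> 'a" where
  "replace_row A k w i j = (if i = k then w j else if j = k then - w i else A i j)"

text \<open>The new entry at \<open>(k, k)\<close> is \<open>w k\<close>, which may be nonzero;
  hence \<open>skew_fun\<close> leaves the diagonal free.\<close>

lemma skew_fun_replace_row:
  assumes "skew_fun A"
  shows "skew_fun (replace_row A k w)"
  unfolding skew_fun_def
proof (intro allI impI)
  fix i j :: nat assume "i \<noteq> j"
  then have "A i j = - A j i" using assms unfolding skew_fun_def by blast
  then show "replace_row A k w i j = - replace_row A k w j i"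
    using \<open>i \<noteq> j\<close> by (auto simp: replace_row_def)
qed

text \<open>Exactly one pair of the listing contains \<open>k\<close>, so \<open>w\<close> enters
  through a single factor, and linearly.\<close>

lemma pf_term_replace_row:
  fixes A :: "nat \<Rightarrow> nat \<Rightarrow> 'a::comm_ring_1"
  assumes p: "p permutes {0..<2 * n}" and k: "k < 2 * n"
  shows "pf_term n (replace_row A k w) p =
    (\<Sum>j<2 * n. w j * pf_term n (replace_row A k (unit_fun j)) p)"
proof -
  obtain x where x: "x < 2 * n" "p x = k"
    using k permutes_image[OF p] by (metis atLeastLessThan_iff imageE zero_le)
  \<comment> \<open>The pair containing \<open>k\<close> stands at positions \<open>2 * m\<close>
    and \<open>2 * m + 1\<close>.\<close>
  define m where "m = x div 2"
  have m: "m < n" "x = 2 * m \<or> x = 2 * m + 1" using x(1) unfolding m_def by presburger+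
  have inj: "p y = p z \<longleftrightarrow> y = z" for y z using permutes_inj[OF p] by (simp add: inj_eq)
  have in_range: "p y < 2 * n" if "y < 2 * n" for y
    using permutes_in_image[OF p, of y] that by simp
  let ?F = "\<lambda>v i. replace_row A k v (p (2 * i)) (p (2 * i + 1))"
  have rest: "(\<Prod>i\<in>{..<n} - {m}. ?F v i) = (\<Prod>i\<in>{..<n} - {m}. A (p (2 * i)) (p (2 * i + 1)))" for v
  proof (rule prod.cong[OF refl])
    fix i assume "i \<in> {..<n} - {m}"
    then have "i \<noteq> m" by simp
    then have "p (2 * i) \<noteq> k \<and> p (2 * i + 1) \<noteq> k"
      using m(2) unfolding x(2)[symmetric] inj by presburger
    then show "?F v i = A (p (2 * i)) (p (2 * i + 1))" by (simp add: replace_row_def)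
  qed
  have split: "(\<Prod>i<n. ?F v i) = ?F v m * (\<Prod>i\<in>{..<n} - {m}. A (p (2 * i)) (p (2 * i + 1)))" for v
    using m(1) by (subst prod.remove[of _ m]) (simp_all only: rest finite_lessThan lessThan_iff)
  have unit: "(\<Sum>j<2 * n. w j * unit_fun j y) = w y" if "y < 2 * n" for y
    using that by (simp add: unit_fun_def if_distrib[of "\<lambda>x. _ * x"] cong: if_cong)
  have "2 * m < 2 * n" "2 * m + 1 < 2 * n" using m(1) by simp_all
  then have "?F w m = (\<Sum>j<2 * n. w j * ?F (unit_fun j) m)"
    using m(2) inj[of "2 * m + 1" "2 * m"] unit[OF in_range] x(2)
    by (auto simp: replace_row_def sum_negf simp del: One_nat_def)
  then show ?thesis
    unfolding pf_term_def split by (simp add: sum_distrib_left sum_distrib_right ac_simps)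
qed

lemma pf_replace_row:
  assumes "k < 2 * n"
  shows "pf n (replace_row A k w) = (\<Sum>j<2 * n. w j * pf n (replace_row A k (unit_fun j)))"
proof -
  have "pf n (replace_row A k w) =
      (\<Sum>p\<in>matchings n. \<Sum>j<2 * n. w j * pf_term n (replace_row A k (unit_fun j)) p)"
    unfolding pf_def using assms
    by (intro sum.cong refl pf_term_replace_row) (auto simp: matchings_def)
  also have "\<dots> = (\<Sum>j<2 * n. \<Sum>p\<in>matchings n. w j * pf_term n (replace_row A k (unit_fun j)) p)"
    by (rule sum.swap)
  finally show ?thesis by (simp add: pf_def sum_distrib_left)
qed

text \<open>The matrix of the Pfaffians \<open>pf n (replace_row A k (unit_fun j))\<close> plays the role of the
  adjugate: its product with \<open>\<phi>\<close> is the Pfaffian times the identity.\<close>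

lemma pfaffian_1_imp_invertible:
  fixes \<phi> :: "'a::comm_ring_1 mat"
  assumes two: "(2 :: 'a) dvd 1" and c: "\<phi> \<in> carrier_mat (2 * n) (2 * n)"
    and skew: "\<phi>\<^sup>T = - \<phi>" and "pfaffian \<phi> = 1"
  obtains \<psi> where "\<psi> \<in> carrier_mat (2 * n) (2 * n)" "\<phi> * \<psi> = 1\<^sub>m (2 * n)" "\<psi> * \<phi> = 1\<^sub>m (2 * n)"
proof -
  \<comment> \<open>The value 0 outside the matrix lets skew-symmetry hold for all indices.\<close>
  define A where "A = (\<lambda>i j. if i < 2 * n \<and> j < 2 * n then \<phi> $$ (i, j) else 0)"
  have neg: "A i j = - A j i" for i j
  proof (cases "i < 2 * n \<and> j < 2 * n")
    case True
    then have "\<phi>\<^sup>T $$ (j, i) = - \<phi> $$ (j, i)" using c skew by simp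
    then show ?thesis using True c by (simp add: A_def)
  qed (auto simp: A_def)
  then have A: "skew_fun A" unfolding skew_fun_def by blast
  have diag: "A i i = 0" for i
    using double_eq_0[OF two, of "A i i"] neg[of i i] by (simp only: eq_neg_iff_add_eq_0)
  have pf_A: "pf n A = 1"
  proof -
    have "pf_term n A p = signof p * (\<Prod>i<n. \<phi> $$ (p (2 * i), p (2 * i + 1)))"
      if "p \<in> matchings n" for p
    proof -
      have "p permutes {0..<2 * n}" using that by (simp add: matchings_def)
      then have "p y < 2 * n" if "y < 2 * n" for y
        using permutes_in_image[of p "{0..<2 * n}" y] that by simp
      then show ?thesis by (simp add: pf_term_def A_def)
    qed
    then have "pf n A = pfaffian \<phi>"
      using c by (simp add: pf_def pfaffian_def matchings_def Let_def)
    then show ?thesis using assms(4) by simp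
  qed
  have row: "pf n (replace_row A k (A l)) = (if l = k then 1 else 0)"
    if "l < 2 * n" "k < 2 * n" for l k
  proof (cases "l = k")
    case True
    have "replace_row A k (A k) i j = A i j" for i j
      using neg[of i k] by (auto simp: replace_row_def)
    then have "replace_row A k (A k) = A" by blast
    then show ?thesis using True pf_A by simp
  next
    case False
    \<comment> \<open>Row \<open>k\<close> is now a copy of row \<open>l\<close>, so exchanging the
      two indices is a symmetry off the diagonal; \<open>A l l = 0\<close> settles the entries
      between \<open>k\<close> and \<open>l\<close>.\<close>
    have "replace_row A k (A l) (transpose k l x) (transpose k l y) = replace_row A k (A l) x y"
      if "x \<noteq> y" for x y
    proof -
      have "x \<noteq> l \<longrightarrow> A x l = - A l x" using neg by blast
      then show ?thesis using that False diag[of l] by (auto simp: replace_row_def transpose_def)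
    qed
    then have "pf n (replace_row A k (A l)) + pf n (replace_row A k (A l)) = 0"
      using pf_double_eq_0[OF skew_fun_replace_row[OF A]] False that by blast
    then have "pf n (replace_row A k (A l)) = 0" by (rule double_eq_0[OF two])
    then show ?thesis using False by simp
  qed
  define M where "M = mat (2 * n) (2 * n) (\<lambda>(j, k). pf n (replace_row A k (unit_fun j)))"
  have M: "M \<in> carrier_mat (2 * n) (2 * n)" by (simp add: M_def)
  have "\<phi> * M = 1\<^sub>m (2 * n)"
  proof (rule eq_matI)
    fix l k assume "l < dim_row (1\<^sub>m (2 * n) :: 'a mat)" "k < dim_col (1\<^sub>m (2 * n) :: 'a mat)"
    then have lk: "l < 2 * n" "k < 2 * n" by simp_all
    have "(\<phi> * M) $$ (l, k) = (\<Sum>j<2 * n. A l j * pf n (replace_row A k (unit_fun j)))"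
      using lk c by (simp add: M_def scalar_prod_def atLeast0LessThan A_def)
    also have "\<dots> = (1\<^sub>m (2 * n)) $$ (l, k)"
      using lk row[OF lk] pf_replace_row[OF lk(2), of A "A l"] by simp
    finally show "(\<phi> * M) $$ (l, k) = (1\<^sub>m (2 * n)) $$ (l, k)" .
  qed (use c M in auto)
  \<comment> \<open>The right inverse \<open>M\<close> shows that the determinant is a unit; the
    adjugate then supplies a two-sided inverse.\<close>
  then have "det \<phi> * det M = 1" using det_mult[OF c M] by simp
  then show thesis using invertible_of_det[OF c] that by blast
qed

theorem theorem4p4:
  fixes \<phi> :: "'a::euclidean_ring mat" and n :: nat
  assumes "is_unit (2 :: 'a)"
    and "n \<ge> 2"
    and "\<phi> \<in> carrier_mat (2 * n) (2 * n)"
    and "skew_symmetric_mat \<phi>"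
    and "pfaffian \<phi> = 1"
  shows "Sp \<phi> = ESp \<phi>"
proof -
  have skew: "\<phi>\<^sup>T = - \<phi>" using assms(4) by (simp add: skew_symmetric_mat_def)
  obtain \<psi> where "\<psi> \<in> carrier_mat (2 * n) (2 * n)" "\<phi> * \<psi> = 1\<^sub>m (2 * n)" "\<psi> * \<phi> = 1\<^sub>m (2 * n)"
    using pfaffian_1_imp_invertible[OF assms(1,3) skew assms(5)] .
  then interpret symplectic_form \<phi> \<psi> "2 * n"
    using assms skew by unfold_locales auto
  show ?thesis using Sp_subset_ESp ESp_subset_Sp by blast
qed

end
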